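(* There is $N_0$ such that for every integer $N \ge N_0$ the following holds. Let $S_2=\{n^2 : n \in \mathbb{N}\}$ be the set of (positive) integer squares. Let $a_0$ be a non-negative integer and let $A=\{a_1, \ldots, a_d\}$ be a set of positive integers such that $H(a_0; a_1, \ldots , a_d)\subset S_2\cap [1,N]$. Then \[ d \leq 7 \log \log N. \]
   Context: For integers $a_0\neq 0, a_1,\dots,a_d$, the Hilbert cube of dimension $d$ is $H(a_0;a_1,\dots,a_d)=\{a_0+\sum_{i=1}^d \varepsilon_i a_i : \varepsilon_i\in\{0,1\}\}$. For $a_0=0$ the definition is amended to exclude the empty sum: $H(0;a_1,\dots,a_d)=\{\sum_{i=1}^d \varepsilon_i a_i : \varepsilon_i\in\{0,1\},\ \sum_i \varepsilon_i>0\}$. $\log$ denotes the natural logarithm. *)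

theory Defs
  imports Complex_Main
begin

text \<open>
  The Hilbert cube \<open>H(a0; a 1, ..., a d)\<close>; the values of \<open>a\<close> and \<open>\<epsilon>\<close> outside \<open>{1..d}\<close> are
  irrelevant. For \<open>a0 = 0\<close> the empty sum (all \<open>\<epsilon> i = 0\<close>) is excluded.
\<close>

definition hilbert_cube :: "int \<Rightarrow> nat \<Rightarrow> (nat \<Rightarrow> int) \<Rightarrow> int set" where
  "hilbert_cube a0 d a =
     {a0 + (\<Sum>i = 1..d. \<epsilon> i * a i) | \<epsilon>.
        (\<forall>i \<in> {1..d}. \<epsilon> i \<in> {0, 1}) \<and> (a0 = 0 \<longrightarrow> (\<Sum>i = 1..d. \<epsilon> i) > 0)}"

definition pos_squares :: "int set" where
  "pos_squares = {n\<^sup>2 | n. n > 0}"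

end

theory Submission
  imports
    Defs
    "HOL-Real_Asymp.Real_Asymp"
    "HOL-Analysis.Harmonic_Numbers"
    "HOL-Computational_Algebra.Nth_Powers"
    "HOL-Number_Theory.Number_Theory"
begin

text \<open>
  Split \<open>A\<close> into halves \<open>B\<close>, \<open>C\<close> and let \<open>X\<close>, \<open>Y\<close> be their sets of subset sums, so that
  \<open>a0 + X + Y\<close> consists of squares. Since there are no four squares in arithmetic progression
  (Fermat), adding one element to \<open>B\<close> enlarges \<open>X\<close> by a factor of at least \<open>4/3\<close>; hence \<open>X\<close> and
  \<open>Y\<close> have at least \<open>(4/3) ^ (d div 2)\<close> elements. On the other hand, a second moment estimate for
  the Legendre symbol shows that modulo each odd prime \<open>p\<close> one of \<open>X\<close>, \<open>Y\<close> occupies at most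
  \<open>sqrt p + 1\<close> residue classes, and Gallagher's larger sieve over the primes up to about
  \<open>(ln N) powr 2.006\<close> bounds the smaller one by \<open>O((ln N) powr 1.003)\<close>. This suffices since
  \<open>2 * 1.003 / ln (4/3) = 6.97... < 7\<close>.
\<close>

subsection \<open>Four squares in arithmetic progression\<close>

text \<open>Dividing \<open>u\<close> and \<open>u'\<close> by their gcd \<open>a\<close> leaves
  coprime cofactors \<open>b\<close>, \<open>c\<close> with \<open>b * v = c * v'\<close>, so
  \<open>c\<close> divides \<open>v\<close>; the quotient is \<open>d\<close>. This is Euler's four
  number lemma.\<close>

lemma four_number_lemma:
  fixes u v u' v' :: nat
  assumes "u > 0" "u * v = u' * v'"
  obtains a b c d where "u = a * b" "v = c * d" "u' = a * c" "v' = b * d" "coprime b c"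
proof -
  define a where "a = gcd u u'"
  have "a > 0" using assms by (simp add: a_def)
  obtain b c where bc: "u = a * b" "u' = a * c" "coprime b c"
    unfolding a_def using gcd_coprime_exists[of u u'] assms
    by (metis gcd_eq_0_iff less_numeral_extra(3) mult.commute)
  have eq: "b * v = c * v'" using assms bc \<open>a > 0\<close> by auto
  then obtain d where d: "v = c * d"
    using bc(3) by (metis coprime_commute coprime_dvd_mult_right_iff dvdE dvd_triv_left)
  show ?thesis
  proof (cases "c = 0")
    \<comment> \<open>Here \<open>u' = 0\<close>, hence \<open>b = 1\<close> and
      \<open>v = 0\<close>. Then \<open>v = c * d\<close> leaves \<open>d\<close> free, and
      \<open>d = v'\<close> satisfies \<open>v' = b * d\<close>.\<close>
    case True
    then have "b = 1" using bc by simp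
    with True eq d bc show ?thesis by (intro that[of a b c v']) auto
  next
    case False
    then have "v' = b * d" using eq d by auto
    with d bc show ?thesis by (intro that) auto
  qed
qed

lemma not_coprime_nat_obtains:
  fixes a b :: nat
  assumes "\<not> coprime a b"
  obtains p where "prime p" "p dvd a" "p dvd b"
proof -
  have "gcd a b \<noteq> 1" using assms coprime_iff_gcd_eq_1 by blast
  then obtain p where "prime p" "p dvd gcd a b" using prime_factor_nat by blast
  then show ?thesis by (intro that) auto
qed

text \<open>With \<open>y = 2 * k\<close> and \<open>z = x + 2 * s\<close> the equation becomes
  \<open>k^2 = s * (s + x)\<close>. The two factors are coprime, so both are squares. The conclusion
  is written with \<open>x + q^2\<close> to avoid subtraction on \<open>nat\<close>.\<close>

lemma pythagorean_triple:
  fixes x y z :: nat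
  assumes "x\<^sup>2 + y\<^sup>2 = z\<^sup>2" "coprime x y" "even y"
  obtains p q where "coprime p q" "x + q\<^sup>2 = p\<^sup>2" "y = 2 * p * q"
proof -
  obtain k where k: "y = 2 * k" using assms by blast
  have "odd x" using assms(2,3) coprime_common_divisor[of x y 2] by auto
  then have "odd z" using assms(1,3) \<open>odd x\<close> even_power[of z 2] even_power[of x 2] even_power[of y 2] even_add[of "x\<^sup>2" "y\<^sup>2"] by auto
  have "x\<^sup>2 \<le> z\<^sup>2" using assms(1) by linarith
  then have "x \<le> z" by simp
  moreover from \<open>odd x\<close> \<open>odd z\<close> have "even (z - x)" by simp
  ultimately obtain s where s: "z = x + 2 * s" by (metis dvdE le_add_diff_inverse)
  have ks: "k\<^sup>2 = s * (s + x)" using assms(1) unfolding k s by (simp add: power2_eq_square algebra_simps)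
  have "coprime s x"
  proof (rule ccontr)
    assume "\<not> coprime s x"
    then obtain p where p: "prime p" "p dvd s" "p dvd x"
      by (rule not_coprime_nat_obtains)
    then have "p dvd k" using ks by (metis dvd_mult2 prime_dvd_power)
    then have "p dvd y" using k by simp
    with assms(2) p(3) have "is_unit p" by (rule coprime_common_divisor)
    with p(1) show False by (simp add: not_prime_unit)
  qed
  then have cop: "coprime s (s + x)" by (simp only: coprime_iff_gcd_eq_1 gcd_add2)
  have "is_nth_power 2 (s * (s + x))" unfolding ks[symmetric] by simp
  then have "is_nth_power 2 s" "is_nth_power 2 (s + x)"
    using is_nth_power_mult_coprime_nat_iff[OF cop] by auto
  then obtain q p where qp: "s = q\<^sup>2" "s + x = p\<^sup>2" by (auto elim!: is_nth_powerE)
  have "k\<^sup>2 = (p * q)\<^sup>2" using ks qp by (simp add: power_mult_distrib)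
  then have "k = p * q" by simp
  moreover have "coprime (q\<^sup>2) (p\<^sup>2)" using cop unfolding qp(2) unfolding qp(1) .
  then have "coprime p q" by (simp add: coprime_commute)
  ultimately show ?thesis using qp k by (intro that[of p q]) auto
qed

section \<open>Fermat descent for x^4 - x^2 y^2 + y^4 = m^2\<close>

lemma three_dvd_sum_squares:
  fixes b c :: nat
  assumes "3 dvd b\<^sup>2 + c\<^sup>2"
  shows "3 dvd b" "3 dvd c"
proof -
  have *: "b mod 3 \<in> {0,1,2}" "c mod 3 \<in> {0,1,2}" by auto
  have "((b mod 3)\<^sup>2 + (c mod 3)\<^sup>2) mod 3 = (((b mod 3)\<^sup>2 mod 3) + ((c mod 3)\<^sup>2 mod 3)) mod 3"
    by (simp only: mod_add_eq)
  also have "\<dots> = (b\<^sup>2 + c\<^sup>2) mod 3" by (simp only: mod_add_eq power_mod)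
  also have "\<dots> = 0" using assms by simp
  finally have "((b mod 3)\<^sup>2 + (c mod 3)\<^sup>2) mod 3 = 0" .
  with * have "b mod 3 = 0 \<and> c mod 3 = 0" by (elim insertE) (simp_all add: power2_eq_square)
  then show "3 dvd b" "3 dvd c" by auto
qed

text \<open>Transfers the quartic to the integers, where identities with differences of squares can
  be checked by ring normalisation.\<close>

lemma quartic_of_nat_iff:
  fixes x y m :: nat
  shows "(int x)^4 + (int y)^4 = (int x)\<^sup>2 * (int y)\<^sup>2 + (int m)\<^sup>2 \<longleftrightarrow>
         x^4 + y^4 = x\<^sup>2 * y\<^sup>2 + m\<^sup>2"
  by (simp only: of_nat_eq_iff flip: of_nat_power of_nat_mult of_nat_add)

text \<open>Infinite descent on \<open>x * y\<close>. The equation says that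
  \<open>x^2 - y^2\<close> and \<open>x * y\<close> are the legs of a primitive Pythagorean triple,
  so \<open>x * y = 2 * p * q\<close> and \<open>y^2 - x^2 = p^2 - q^2\<close>. Splitting
  \<open>x' * y = p * q\<close> (with \<open>x = 2 * x'\<close>) by the four number lemma leads to
  \<open>b^2 + c^2 = a^2\<close> and \<open>4 * b^2 + c^2 = d^2\<close>. The second is again a
  primitive triple, with \<open>b = r * s\<close> and \<open>c = r^2 - s^2\<close>; the first then
  becomes the same quartic for \<open>r\<close>, \<open>s\<close>, whose product \<open>b\<close> is
  below \<open>x\<close>.\<close>

lemma quartic_even_not_square:
  fixes x y m :: nat
  assumes "coprime x y" "even x" "x > 0" "y > 0" "x^4 + y^4 = x\<^sup>2 * y\<^sup>2 + m\<^sup>2"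
  shows False
  using assms
proof (induction "x * y" arbitrary: x y m rule: less_induct)
  case less
  have "odd y" using less.prems(1,2) coprime_common_divisor[of x y 2] by auto
  define w where "w = (if x\<^sup>2 \<ge> y\<^sup>2 then x\<^sup>2 - y\<^sup>2 else y\<^sup>2 - x\<^sup>2)"
  have w: "x\<^sup>2 = y\<^sup>2 + w \<or> y\<^sup>2 = x\<^sup>2 + w" by (auto simp: w_def)
  have eq: "w\<^sup>2 + (x * y)\<^sup>2 = m\<^sup>2"
  proof -
    from w have "int (x\<^sup>2) = int (y\<^sup>2 + w) \<or> int (y\<^sup>2) = int (x\<^sup>2 + w)" by metis
    then have "int w = int x^2 - int y^2 \<or> int w = int y^2 - int x^2" by auto
    then have "(int w)\<^sup>2 = (int x^2 - int y^2)^2" by (metis power2_commute)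
    moreover have "(int x)^4 + (int y)^4 = (int x)\<^sup>2 * (int y)\<^sup>2 + (int m)\<^sup>2"
      using less.prems(5) by (simp only: quartic_of_nat_iff)
    moreover have "((int x)\<^sup>2 - (int y)\<^sup>2)\<^sup>2 + (int x * int y)\<^sup>2 = (int x)^4 + (int y)^4 - (int x)\<^sup>2 * (int y)\<^sup>2"
      by (simp add: power2_eq_square power4_eq_xxxx algebra_simps)
    ultimately have "(int w)\<^sup>2 + (int x * int y)\<^sup>2 = (int m)\<^sup>2" by linarith
    then show ?thesis by (simp only: of_nat_eq_iff flip: of_nat_power of_nat_mult of_nat_add)
  qed
  have cop: "coprime w (x * y)"
  proof (rule ccontr)
    assume "\<not> coprime w (x * y)"
    then obtain p where p: "prime p" "p dvd w" "p dvd x * y"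
      by (rule not_coprime_nat_obtains)
    then have "p dvd x \<or> p dvd y" by (simp add: prime_dvd_mult_iff)
    then have "p dvd x\<^sup>2 \<or> p dvd y\<^sup>2" by (auto simp: power2_eq_square)
    moreover have "p dvd x\<^sup>2 \<longleftrightarrow> p dvd y\<^sup>2"
      using w dvd_add_left_iff[OF p(2), of "x\<^sup>2"] dvd_add_left_iff[OF p(2), of "y\<^sup>2"] by metis
    ultimately have "p dvd x\<^sup>2 \<and> p dvd y\<^sup>2" by blast
    then have "p dvd x" "p dvd y" using p(1) prime_dvd_power by blast+
    with less.prems(1) have "is_unit p" by (rule coprime_common_divisor)
    with p(1) show False by (simp add: not_prime_unit)
  qed
  obtain p0 q0 where 0: "coprime p0 q0" "w + q0\<^sup>2 = p0\<^sup>2" "x * y = 2 * p0 * q0"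
  proof (rule pythagorean_triple[OF eq cop])
    show "even (x * y)" using less.prems(2) by simp
  qed
  \<comment> \<open>Exchanging \<open>p0\<close> and \<open>q0\<close> according to the sign of
    \<open>x^2 - y^2\<close> gives one equation covering both cases.\<close>
  obtain p q where pq: "coprime p q" "y\<^sup>2 + q\<^sup>2 = x\<^sup>2 + p\<^sup>2" "x * y = 2 * p * q"
  proof -
    from w show ?thesis
    proof
      assume "x\<^sup>2 = y\<^sup>2 + w"
      then show ?thesis using 0 by (intro that[of q0 p0]) (auto simp: coprime_commute)
    next
      assume "y\<^sup>2 = x\<^sup>2 + w"
      then show ?thesis using 0 by (intro that[of p0 q0]) (auto simp: coprime_commute)
    qed
  qed
  obtain x' where x': "x = 2 * x'" using less.prems(2) by blast
  have "x' > 0" "x' * y = p * q" using less.prems(3) pq(3) x' by auto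
  then obtain a b c d where abcd: "x' = a * b" "y = c * d" "p = a * c" "q = b * d" "coprime b c"
    by (rule four_number_lemma)
  have pos: "a > 0" "b > 0" "c > 0" "d > 0" using \<open>x' > 0\<close> less.prems(4) abcd by auto
  have main: "d\<^sup>2 * (b\<^sup>2 + c\<^sup>2) = a\<^sup>2 * (4 * b\<^sup>2 + c\<^sup>2)"
    using pq(2) unfolding x' abcd by (simp add: power2_eq_square algebra_simps)
  have "coprime a d" using less.prems(1) unfolding x' abcd by simp
  then have "coprime (a\<^sup>2) (d\<^sup>2)" by simp
  then have "a\<^sup>2 dvd b\<^sup>2 + c\<^sup>2" using main by (metis coprime_dvd_mult_right_iff dvd_triv_left)
  then obtain t where t: "b\<^sup>2 + c\<^sup>2 = a\<^sup>2 * t" by blast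
  have t': "4 * b\<^sup>2 + c\<^sup>2 = d\<^sup>2 * t" using main t pos by simp
  \<comment> \<open>The common cofactor \<open>t\<close> divides the combinations
    \<open>3 * b^2\<close> and \<open>3 * c^2\<close> of the two sums, hence 3, as \<open>b\<close>
    and \<open>c\<close> are coprime. The value 3 is impossible, since it would make both
    \<open>b\<close> and \<open>c\<close> divisible by 3.\<close>
  have "t dvd 3 * b\<^sup>2"
  proof -
    have "3 * b\<^sup>2 = (4 * b\<^sup>2 + c\<^sup>2) - (b\<^sup>2 + c\<^sup>2)" by simp
    then show ?thesis using t t' by (metis dvd_diff_nat dvd_triv_right)
  qed
  moreover have "t dvd 3 * c\<^sup>2"
  proof -
    have "3 * c\<^sup>2 = 4 * (b\<^sup>2 + c\<^sup>2) - (4 * b\<^sup>2 + c\<^sup>2)" by simp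
    then show ?thesis using t t' by (metis dvd_diff_nat dvd_triv_right dvd_mult)
  qed
  ultimately have "t dvd gcd (3 * b\<^sup>2) (3 * c\<^sup>2)" by simp
  also have "gcd (3 * b\<^sup>2) (3 * c\<^sup>2) = 3"
    using abcd(5) by (simp add: gcd_mult_distrib_nat[symmetric])
  finally have "t dvd 3" .
  then have "t = 1 \<or> t = 3" using prime_nat_iff[of 3] by simp
  moreover have "t \<noteq> 3"
  proof
    assume "t = 3"
    then have "3 dvd b\<^sup>2 + c\<^sup>2" using t by simp
    from three_dvd_sum_squares[OF this] have "is_unit (3::nat)"
      using abcd(5) coprime_common_divisor by blast
    then show False by simp
  qed
  ultimately have t1: "t = 1" by blast
  have "odd c" "odd d" using \<open>odd y\<close> abcd by auto
  have "c\<^sup>2 + (2 * b)\<^sup>2 = d\<^sup>2" using t' t1 by (simp add: power_mult_distrib)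
  moreover have "coprime c (2 * b)" using abcd(5) \<open>odd c\<close> by (simp add: coprime_commute)
  moreover have "even (2 * b)" by simp
  ultimately obtain r s where rs: "coprime r s" "c + s\<^sup>2 = r\<^sup>2" "2 * b = 2 * r * s"
    by (rule pythagorean_triple)
  have b: "b = r * s" using rs by simp
  have rspos: "r > 0" "s > 0" using b pos by auto
  have A: "r^4 + s^4 = r\<^sup>2 * s\<^sup>2 + a\<^sup>2"
  proof -
    have "int (c + s\<^sup>2) = int (r\<^sup>2)" "int ((r * s)\<^sup>2 + c\<^sup>2) = int (a\<^sup>2)"
      using rs(2) t t1 b by auto
    then have "int c = int r^2 - int s^2" "(int r * int s)^2 + int c^2 = int a^2" by auto
    then have "(int r * int s)^2 + (int r^2 - int s^2)^2 = int a^2" by simp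
    then have "(int r)^4 + (int s)^4 = (int r)\<^sup>2 * (int s)\<^sup>2 + (int a)\<^sup>2"
      by (simp add: power2_eq_square power4_eq_xxxx algebra_simps)
    then show ?thesis by (simp only: of_nat_eq_iff flip: of_nat_power of_nat_mult of_nat_add)
  qed
  have less_xy: "r * s < x * y"
  proof -
    have "r * s \<le> a * b" using b pos by simp
    also have "\<dots> < x" using x' abcd \<open>x' > 0\<close> by simp
    also have "\<dots> \<le> x * y" using less.prems(4) by simp
    finally show ?thesis .
  qed
  \<comment> \<open>As \<open>c = r^2 - s^2\<close> is odd, one of \<open>r\<close>,
    \<open>s\<close> is even; the quartic is symmetric, so the even one can take the first place in
    the induction hypothesis.\<close>
  have "even r \<or> even s" using \<open>odd c\<close> even_add[of c "s\<^sup>2"] rs(2) by auto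
  then show False
  proof (elim disjE)
    assume "even r"
    with less_xy rs(1) rspos A show False using less.hyps by blast
  next
    assume "even s"
    moreover have "s * r < x * y" using less_xy by (simp add: mult.commute)
    moreover have "coprime s r" using rs(1) by (simp add: coprime_commute)
    moreover have "s^4 + r^4 = s\<^sup>2 * r\<^sup>2 + a\<^sup>2" using A by (simp add: algebra_simps)
    ultimately show False using less.hyps rspos by blast
  qed
qed

text \<open>If \<open>x\<close> and \<open>y\<close> are both odd, the even leg of the triple is now
  \<open>w = x^2 - y^2\<close>, so \<open>w = 2 * p * q\<close> and
  \<open>x * y = p^2 - q^2\<close>. With \<open>h = (x^2 + y^2) / 2\<close> these combine to the
  same quartic for \<open>p\<close>, \<open>q\<close>, \<open>h\<close>, where one of
  \<open>p\<close>, \<open>q\<close> is even: the case already excluded. The strict inequality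
  \<open>x > y\<close> makes \<open>w\<close>, and so \<open>p\<close> and \<open>q\<close>,
  positive.\<close>

lemma quartic_not_square_less:
  fixes x y m :: nat
  assumes "coprime x y" "x > y" "y > 0" "x^4 + y^4 = x\<^sup>2 * y\<^sup>2 + m\<^sup>2"
  shows False
proof (cases "even x \<or> even y")
  case True
  then show ?thesis
    using quartic_even_not_square[of x y m] quartic_even_not_square[of y x m] assms
    by (auto simp: mult.commute coprime_commute add.commute)
next
  case False
  then have odd: "odd x" "odd y" by auto
  define w where "w = x\<^sup>2 - y\<^sup>2"
  have "y\<^sup>2 < x\<^sup>2" using assms(2) by (simp add: power_strict_mono)
  then have w: "x\<^sup>2 = y\<^sup>2 + w" "w > 0" by (auto simp: w_def)
  have "int (x\<^sup>2) = int (y\<^sup>2 + w)" using w by metis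
  then have wint: "int w = int x^2 - int y^2" by simp
  have eq: "(x * y)\<^sup>2 + w\<^sup>2 = m\<^sup>2"
  proof -
    have "(int x)^4 + (int y)^4 = (int x)\<^sup>2 * (int y)\<^sup>2 + (int m)\<^sup>2"
      using assms(4) by (simp only: quartic_of_nat_iff)
    moreover have "((int x)\<^sup>2 - (int y)\<^sup>2)\<^sup>2 + (int x * int y)\<^sup>2 = (int x)^4 + (int y)^4 - (int x)\<^sup>2 * (int y)\<^sup>2"
      by (simp add: power2_eq_square power4_eq_xxxx algebra_simps)
    ultimately have "(int x * int y)\<^sup>2 + (int w)\<^sup>2 = (int m)\<^sup>2" using wint by simp
    then show ?thesis by (simp only: of_nat_eq_iff flip: of_nat_power of_nat_mult of_nat_add)
  qed
  have cop: "coprime (x * y) w"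
  proof -
    have "coprime (x\<^sup>2) (y\<^sup>2)" using assms(1) by simp
    moreover have "gcd (x\<^sup>2) (y\<^sup>2) = gcd w (y\<^sup>2)" unfolding w(1) by (simp add: add.commute[of _ w])
    moreover have "gcd (x\<^sup>2) w = gcd (y\<^sup>2) w" unfolding w(1) by simp
    ultimately have "coprime (x\<^sup>2) w" "coprime (y\<^sup>2) w"
      by (metis coprime_iff_gcd_eq_1 gcd.commute)+
    then show ?thesis by simp
  qed
  have "odd (y\<^sup>2 + w)" using odd unfolding w(1)[symmetric] by simp
  then have "even w" using odd by simp
  then obtain p q where pq: "coprime p q" "x * y + q\<^sup>2 = p\<^sup>2" "w = 2 * p * q"
    by (rule pythagorean_triple[OF eq cop])
  have pos: "p > 0" "q > 0" using w pq by auto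
  have "even (x\<^sup>2 + y\<^sup>2)" using odd by simp
  then obtain h where h: "x\<^sup>2 + y\<^sup>2 = 2 * h" by blast
  have "p^4 + q^4 = p\<^sup>2 * q\<^sup>2 + h\<^sup>2"
  proof -
    have "int x^2 + int y^2 = 2 * int h" using arg_cong[OF h, of int] by simp
    moreover have "int (x * y + q\<^sup>2) = int (p\<^sup>2)" using pq(2) by metis
    then have "int x * int y = int p^2 - int q^2" by simp
    moreover have "int x^2 - int y^2 = 2 * int p * int q" using wint pq(3) by simp
    moreover have "(int x^2 + int y^2)\<^sup>2 = (int x^2 - int y^2)\<^sup>2 + 4 * (int x * int y)\<^sup>2"
      by (simp add: power2_eq_square algebra_simps)
    ultimately have "(2 * int h)\<^sup>2 = (2 * int p * int q)\<^sup>2 + 4 * (int p^2 - int q^2)\<^sup>2" by metis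
    then have "4 * ((int p)^4 + (int q)^4) = 4 * ((int p)\<^sup>2 * (int q)\<^sup>2 + (int h)\<^sup>2)"
      by (simp add: power2_eq_square power4_eq_xxxx algebra_simps)
    then have "(int p)^4 + (int q)^4 = (int p)\<^sup>2 * (int q)\<^sup>2 + (int h)\<^sup>2" by simp
    then show ?thesis by (simp only: of_nat_eq_iff flip: of_nat_power of_nat_mult of_nat_add)
  qed
  moreover have "even p \<or> even q" using odd even_add[of "x * y" "q\<^sup>2"] pq(2) by auto
  ultimately show ?thesis
    using quartic_even_not_square[of p q h] quartic_even_not_square[of q p h] pq(1) pos
    by (auto simp: mult.commute coprime_commute add.commute)
qed

text \<open>Restores the symmetry in \<open>x\<close> and \<open>y\<close>. The condition
  \<open>x \<noteq> y\<close> excludes the genuine solution \<open>x = y = m = 1\<close>.\<close>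

lemma quartic_not_square:
  fixes x y m :: nat
  assumes "coprime x y" "x > 0" "y > 0" "x \<noteq> y" "x^4 + y^4 = x\<^sup>2 * y\<^sup>2 + m\<^sup>2"
  shows False
proof (cases "x > y")
  case True
  with quartic_not_square_less assms show ?thesis by blast
next
  case False
  with assms(4) have "y > x" by simp
  moreover have "coprime y x" using assms(1) by (simp add: coprime_commute)
  moreover have "y^4 + x^4 = y\<^sup>2 * x\<^sup>2 + m\<^sup>2" using assms(5) by (simp add: algebra_simps)
  ultimately show ?thesis using quartic_not_square_less assms(2) by blast
qed

text \<open>Put \<open>z = x + 2 * v\<close>, \<open>u = x + v\<close> and
  \<open>w = y + 2 * v'\<close>, \<open>u' = y + v'\<close>. Then
  \<open>z^2 - x^2 = w^2 - y^2 = 2 * D\<close> gives \<open>u * v = u' * v'\<close>, and the four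
  number lemma applies. Comparing \<open>y = a * c - b * d\<close> with
  \<open>y^2 = u^2 + v^2\<close> yields a quadratic relation between \<open>a\<close> and
  \<open>d\<close>; since it has an integer solution, its discriminant is a square, and this is the
  quartic for \<open>b\<close>, \<open>c\<close>.\<close>

lemma no_four_squares_in_AP_nat:
  fixes x y z w D :: nat
  assumes "D > 0" "y\<^sup>2 = x\<^sup>2 + D" "z\<^sup>2 = y\<^sup>2 + D" "w\<^sup>2 = z\<^sup>2 + D"
  shows False
proof -
  have "x\<^sup>2 < z\<^sup>2" "y\<^sup>2 < w\<^sup>2" using assms by linarith+
  then have "x < z" "y < w" by (simp_all add: power2_less_imp_less)
  have "even (z - x)"
  proof -
    have "z\<^sup>2 = x\<^sup>2 + 2 * D" using assms by simp
    then have "even (z\<^sup>2) = even (x\<^sup>2)" by simp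
    then show ?thesis by simp
  qed
  then obtain v where v: "z = x + 2 * v" using \<open>x < z\<close> by (metis dvdE le_add_diff_inverse less_imp_le)
  have "even (w - y)"
  proof -
    have "w\<^sup>2 = y\<^sup>2 + 2 * D" using assms by simp
    then have "even (w\<^sup>2) = even (y\<^sup>2)" by simp
    then show ?thesis by simp
  qed
  then obtain v' where v': "w = y + 2 * v'" using \<open>y < w\<close> by (metis dvdE le_add_diff_inverse less_imp_le)
  define u where "u = x + v"
  define u' where "u' = y + v'"
  have vpos: "v > 0" "v' > 0" using v v' \<open>x < z\<close> \<open>y < w\<close> by auto
  then have upos: "u > 0" "u' > 0" by (auto simp: u_def u'_def)
  have D: "D = 2 * (u * v)" "D = 2 * (u' * v')"
    using assms v v' unfolding u_def u'_def by (auto simp: power2_eq_square algebra_simps)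
  have y: "y\<^sup>2 = u\<^sup>2 + v\<^sup>2"
    using assms(2) unfolding D(1) by (simp add: u_def power2_eq_square algebra_simps)
  obtain a b c d where abcd: "u = a * b" "v = c * d" "u' = a * c" "v' = b * d" "coprime b c"
  proof (rule four_number_lemma[OF upos(1)])
    show "u * v = u' * v'" using D by simp
  qed
  have pos: "a > 0" "b > 0" "c > 0" "d > 0" using abcd upos vpos by auto
  have yac: "int y = int a * int c - int b * int d" using arg_cong[OF abcd(3), of int] abcd(4) unfolding u'_def by simp
  have y2: "(int y)\<^sup>2 = (int a * int b)\<^sup>2 + (int c * int d)\<^sup>2"
    using y unfolding abcd by (simp only: of_nat_eq_iff flip: of_nat_power of_nat_mult of_nat_add)
  define k where "k = int b^2 - int c^2"
  \<comment> \<open>The relation is \<open>k * a^2 + 2 * a * b * c * d = k * d^2\<close>; it is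
    multiplied by \<open>k\<close> and the square is completed.\<close>
  have key: "(k * int a + int b * int c * int d)\<^sup>2 = (int d)\<^sup>2 * (k\<^sup>2 + (int b * int c)\<^sup>2)"
  proof -
    have "(int a)\<^sup>2 * k + 2 * int a * int b * int c * int d = (int d)\<^sup>2 * k"
      using y2 unfolding yac k_def by (simp add: power2_eq_square algebra_simps)
    then have "k * ((int a)\<^sup>2 * k + 2 * int a * int b * int c * int d) = k * ((int d)\<^sup>2 * k)" by simp
    then show ?thesis by (simp add: power2_eq_square algebra_simps)
  qed
  then have "(int d)\<^sup>2 dvd (k * int a + int b * int c * int d)\<^sup>2" by simp
  then have "int d dvd k * int a + int b * int c * int d" by simp
  then obtain m where "k * int a + int b * int c * int d = int d * m" by blast
  with key have "(int d)\<^sup>2 * m\<^sup>2 = (int d)\<^sup>2 * (k\<^sup>2 + (int b * int c)\<^sup>2)" by (simp add: power_mult_distrib)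
  then have "m\<^sup>2 = k\<^sup>2 + (int b * int c)\<^sup>2" using pos by simp
  then have "(int b)^4 + (int c)^4 = (int b)\<^sup>2 * (int c)\<^sup>2 + (int (nat \<bar>m\<bar>))\<^sup>2" 
    unfolding k_def by (simp add: power2_eq_square power4_eq_xxxx algebra_simps)
  then have "b^4 + c^4 = b\<^sup>2 * c\<^sup>2 + (nat \<bar>m\<bar>)\<^sup>2" by (simp only: quartic_of_nat_iff)
  \<comment> \<open>Coprime and equal means \<open>b = c = 1\<close>, the trivial solution of the
    quartic; then \<open>(a - d)^2 = a^2 + d^2\<close>, which is impossible for positive
    \<open>a\<close>, \<open>d\<close>.\<close>
  moreover have "b \<noteq> c"
  proof
    assume "b = c"
    then have "b = 1" "c = 1" using abcd(5) by auto
    then have "2 * int a * int d = 0"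
      using y2 unfolding yac by (simp add: power2_eq_square algebra_simps)
    then show False using pos by simp
  qed
  ultimately show False using quartic_not_square abcd(5) pos by blast
qed

lemma no_four_squares_in_AP:
  fixes x y z w D :: int
  assumes "D > 0" "y\<^sup>2 = x\<^sup>2 + D" "z\<^sup>2 = y\<^sup>2 + D" "w\<^sup>2 = z\<^sup>2 + D"
  shows False
proof -
  have *: "(nat \<bar>b\<bar>)\<^sup>2 = (nat \<bar>a\<bar>)\<^sup>2 + nat D" if "b\<^sup>2 = a\<^sup>2 + D" for a b :: int
  proof -
    have "int ((nat \<bar>b\<bar>)\<^sup>2) = int ((nat \<bar>a\<bar>)\<^sup>2 + nat D)" using that assms(1) by simp
    then show ?thesis by (simp only: of_nat_eq_iff)
  qed
  have "nat D > 0" using assms(1) by simp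
  from no_four_squares_in_AP_nat[OF this *[OF assms(2)] *[OF assms(3)] *[OF assms(4)]]
  show False .
qed

subsection \<open>Growth of subset sums\<close>

definition subset_sums :: "int set \<Rightarrow> int set" where
  "subset_sums A = \<Sum> ` Pow A"

lemma finite_subset_sums: "finite A \<Longrightarrow> finite (subset_sums A)"
  by (simp add: subset_sums_def)

lemma subset_sums_insert:
  assumes "finite A" "x \<notin> A"
  shows "subset_sums (insert x A) = subset_sums A \<union> (+) x ` subset_sums A"
proof -
  have "\<Sum> (insert x S) = x + \<Sum> S" if "S \<in> Pow A" for S
    using that assms by (subst sum.insert) (auto intro: finite_subset)
  then have "\<Sum> ` insert x ` Pow A = (+) x ` \<Sum> ` Pow A"
    unfolding image_image by (rule image_cong[OF refl])
  then show ?thesis by (simp add: subset_sums_def Pow_insert image_Un)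
qed

lemma add_subset_sums_in_subset_sums_Un:
  assumes "finite A" "finite B" "A \<inter> B = {}" "s \<in> subset_sums A" "t \<in> subset_sums B"
  shows "s + t \<in> subset_sums (A \<union> B)"
proof -
  obtain S T where ST: "S \<subseteq> A" "T \<subseteq> B" "s = \<Sum> S" "t = \<Sum> T"
    using assms(4,5) by (auto simp: subset_sums_def)
  then have "s + t = \<Sum> (S \<union> T)"
    using assms by (subst sum.union_disjoint) (auto intro: finite_subset)
  then show ?thesis using ST by (auto simp: subset_sums_def)
qed

text \<open>Every element of \<open>X\<close> is at most two steps of size \<open>h\<close> below one whose successor leaves \<open>X\<close>.\<close>
lemma card_Un_translate_AP4_free:
  fixes X :: "int set"
  assumes "finite X" "\<And>y. y \<in> X \<Longrightarrow> y + h \<in> X \<Longrightarrow> y + 2 * h \<in> X \<Longrightarrow> y + 3 * h \<notin> X"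
  shows "4 * card X \<le> 3 * card (X \<union> (+) h ` X)"
proof -
  define E where "E = {y \<in> X. h + y \<notin> X}"
  have finE: "finite E" using assms(1) by (simp add: E_def)
  have "X \<subseteq> E \<union> ((\<lambda>y. y - h) ` E \<union> (\<lambda>y. y - 2 * h) ` E)"
  proof
    fix y assume y: "y \<in> X"
    have mem: "z \<in> (\<lambda>y. y - k) ` E" if "z + k \<in> E" for z k
      using that by (intro image_eqI[of _ _ "z + k"]) auto
    consider "h + y \<notin> X" | "y + h \<in> X" "h + (y + h) \<notin> X"
      | "y + h \<in> X" "y + 2 * h \<in> X" "h + (y + 2 * h) \<notin> X"
      using assms(2)[OF y] by (force simp: algebra_simps)
    then show "y \<in> E \<union> ((\<lambda>y. y - h) ` E \<union> (\<lambda>y. y - 2 * h) ` E)"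
      using y mem[of y h] mem[of y "2 * h"] by cases (auto simp: E_def)
  qed
  then have "card X \<le> card (E \<union> ((\<lambda>y. y - h) ` E \<union> (\<lambda>y. y - 2 * h) ` E))"
    using finE by (intro card_mono) auto
  also have "\<dots> \<le> card E + (card ((\<lambda>y. y - h) ` E) + card ((\<lambda>y. y - 2 * h) ` E))"
    by (rule order.trans[OF card_Un_le]) (simp add: card_Un_le)
  also have "\<dots> \<le> card E + (card E + card E)"
    by (intro add_mono card_image_le finE order.refl)
  finally have X3: "card X \<le> 3 * card E" by simp
  \<comment> \<open>Exactly the translates of \<open>E\<close> are new, so the union gains
    \<open>card E\<close>, at least a third of \<open>card X\<close>.\<close>
  have "X \<union> (+) h ` X = X \<union> (+) h ` E" by (auto simp: E_def)
  also have "card \<dots> = card X + card ((+) h ` E)"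
    using assms(1) finE by (intro card_Un_disjoint) (auto simp: E_def)
  also have "card ((+) h ` E) = card E" by (intro card_image) (auto simp: inj_on_def)
  finally show ?thesis using X3 by simp
qed

text \<open>Inserting \<open>x\<close> replaces the set of sums by its union with a translate by
  \<open>x\<close>. Four sums in progression with difference \<open>x\<close> would give four
  squares in progression, so each insertion gains a factor 4/3. Denominators are cleared to stay in
  \<open>nat\<close>.\<close>

lemma card_subset_sums_ge:
  assumes "finite A" "\<And>x. x \<in> A \<Longrightarrow> x > 0"
    and "\<And>s. s \<in> subset_sums A \<Longrightarrow> \<exists>n. c + s = n\<^sup>2"
  shows "4 ^ card A \<le> 3 ^ card A * card (subset_sums A)"
  using assms
proof (induction A rule: finite_induct)
  case empty
  show ?case by (simp add: subset_sums_def)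
next
  case (insert x A)
  let ?X = "subset_sums A"
  have sub: "subset_sums (insert x A) = ?X \<union> (+) x ` ?X"
    using insert.hyps by (rule subset_sums_insert)
  have IH: "4 ^ card A \<le> 3 ^ card A * card ?X"
    using insert.prems sub by (intro insert.IH) auto
  have "4 * card ?X \<le> 3 * card (?X \<union> (+) x ` ?X)"
  proof (rule card_Un_translate_AP4_free)
    show "finite ?X" using insert.hyps by (simp add: finite_subset_sums)
    fix y assume y: "y \<in> ?X" "y + x \<in> ?X" "y + 2 * x \<in> ?X"
    show "y + 3 * x \<notin> ?X"
    proof
      assume "y + 3 * x \<in> ?X"
      with y sub insert.prems(2) obtain k l m n
        where "c + y = k\<^sup>2" "c + (y + x) = l\<^sup>2" "c + (y + 2 * x) = m\<^sup>2" "c + (y + 3 * x) = n\<^sup>2"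
        by (metis UnI1)
      then show False
        using no_four_squares_in_AP[of x l k m n] insert.prems(1)[of x] by simp
    qed
  qed
  then have "3 ^ card A * (4 * card ?X) \<le> 3 ^ card A * (3 * card (subset_sums (insert x A)))"
    unfolding sub by (rule mult_left_mono) simp
  moreover have "4 * 4 ^ card A \<le> 4 * (3 ^ card A * card ?X)"
    using IH by (rule mult_left_mono) simp
  ultimately have "4 * 4 ^ card A \<le> 3 ^ card A * (3 * card (subset_sums (insert x A)))"
    by linarith
  then show ?case using insert.hyps by (simp add: mult_ac)
qed

subsection \<open>Legendre symbols on sumsets\<close>

text \<open>The third premise makes \<open>h\<close> a permutation of the residues modulo
  \<open>p\<close>. It is applied to translations and to multiplications by a unit.\<close>

lemma sum_residues_reindex:
  fixes f :: "int \<Rightarrow> int" and p :: int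
  assumes "p > 0" "\<And>x. f (x mod p) = f x"
    and "\<And>x y. h x mod p = h y mod p \<Longrightarrow> x mod p = y mod p"
  shows "(\<Sum>x\<in>{0..<p}. f (h x)) = (\<Sum>x\<in>{0..<p}. f x)"
proof -
  have inj: "inj_on (\<lambda>x. h x mod p) {0..<p}"
  proof (rule inj_onI)
    fix x y assume "x \<in> {0..<p}" "y \<in> {0..<p}" "h x mod p = h y mod p"
    then show "x = y" using assms(3)[of x y] by simp
  qed
  have "(\<lambda>x. h x mod p) ` {0..<p} = {0..<p}"
    using assms(1) inj by (intro endo_inj_surj) auto
  then have "(\<Sum>x\<in>{0..<p}. f x) = (\<Sum>x\<in>(\<lambda>x. h x mod p) ` {0..<p}. f x)" by simp
  also have "\<dots> = (\<Sum>x\<in>{0..<p}. f (h x mod p))" using inj by (subst sum.reindex) simp_all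
  finally show ?thesis by (simp add: assms(2))
qed

context
  fixes p :: nat
  assumes prime: "prime p" and gt2: "p > 2"
begin

lemma Legendre_mod: "Legendre (x mod int p) (int p) = Legendre x (int p)"
  by (simp add: Legendre_def QuadRes_def cong_def)

lemma Legendre_cases: "Legendre x q \<in> {-1, 0, 1}"
  by (simp add: Legendre_def)

text \<open>By Euler's criterion both sides agree modulo \<open>p\<close>; they differ by at most 2,
  which is less than \<open>p\<close>.\<close>

lemma Legendre_mult: "Legendre (x * y) (int p) = Legendre x (int p) * Legendre y (int p)"
proof -
  let ?L = "\<lambda>x. Legendre x (int p)"
  have "[?L (x * y) = (x * y) ^ ((p - 1) div 2)] (mod int p)"
    by (rule euler_criterion[OF prime gt2])
  also have "(x * y) ^ ((p - 1) div 2) = x ^ ((p - 1) div 2) * y ^ ((p - 1) div 2)"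
    by (rule power_mult_distrib)
  also have "[\<dots> = ?L x * ?L y] (mod int p)"
    by (intro cong_mult cong_sym[OF euler_criterion[OF prime gt2]])
  finally have "int p dvd ?L (x * y) - ?L x * ?L y" by (simp add: cong_iff_dvd_diff)
  moreover have "\<bar>?L (x * y) - ?L x * ?L y\<bar> \<le> 2"
    using Legendre_cases[of x "int p"] Legendre_cases[of y "int p"] Legendre_cases[of "x * y" "int p"]
    by auto
  ultimately have "?L (x * y) - ?L x * ?L y = 0"
    using gt2 zdvd_imp_le[of "int p" "\<bar>?L (x * y) - ?L x * ?L y\<bar>"] by (cases "?L (x * y) - ?L x * ?L y = 0") auto
  then show ?thesis by simp
qed

lemma Legendre_square: "Legendre x (int p) * Legendre x (int p) = (if int p dvd x then 0 else 1)"
  by (auto simp: Legendre_def cong_0_iff)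

lemma mod_mult_cancel:
  assumes "\<not> int p dvd c" "(c * x) mod int p = (c * y) mod int p"
  shows "x mod int p = y mod int p"
proof -
  have "coprime c (int p)"
    using prime_imp_coprime[of "int p" c] assms(1) prime by (simp add: coprime_commute)
  moreover have "[c * x = c * y] (mod int p)" using assms(2) by (simp only: cong_def)
  ultimately have "[x = y] (mod int p)" by (simp only: cong_mult_lcancel)
  then show ?thesis by (simp only: cong_def)
qed

text \<open>Squaring sends 1 and \<open>p - 1\<close> to the same residue, so on a finite set it is
  not surjective either.\<close>

lemma nonresidue_exists: obtains g where "Legendre g (int p) = -1"
proof -
  let ?sq = "\<lambda>x. (x * x) mod int p"
  have "\<not> inj_on ?sq {0..<int p}"
  proof
    assume inj: "inj_on ?sq {0..<int p}"
    have "(int p - 1) * (int p - 1) = int p * (int p - 2) + 1" by (simp add: algebra_simps)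
    then have "int p dvd (int p - 1) * (int p - 1) - 1 * 1" by simp
    then have "?sq (int p - 1) = ?sq 1" by (simp only: mod_eq_dvd_iff)
    moreover have "int p - 1 \<in> {0..<int p}" "1 \<in> {0..<int p}" using gt2 by auto
    ultimately have "int p - 1 = 1" using inj by (rule inj_onD[rotated 1])
    then show False using gt2 by simp
  qed
  then have "?sq ` {0..<int p} \<noteq> {0..<int p}" using eq_card_imp_inj_on[of "{0..<int p}" ?sq] by auto
  moreover have "?sq ` {0..<int p} \<subseteq> {0..<int p}" using gt2 by auto
  ultimately obtain g where g: "g \<in> {0..<int p}" "g \<notin> ?sq ` {0..<int p}" by blast
  have "\<not> QuadRes (int p) g"
  proof
    assume "QuadRes (int p) g"
    then obtain y where "[y\<^sup>2 = g] (mod int p)" by (auto simp: QuadRes_def)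
    then have "?sq (y mod int p) = g" using g(1)
      by (simp add: cong_def power2_eq_square mod_mult_eq)
    moreover have "y mod int p \<in> {0..<int p}" using gt2 by simp
    ultimately show False using g(2) by blast
  qed
  moreover have "\<not> [g = 0] (mod int p)"
  proof
    assume "[g = 0] (mod int p)"
    then have "[0\<^sup>2 = g] (mod int p)" by (simp add: cong_def)
    then have "QuadRes (int p) g" unfolding QuadRes_def by blast
    with \<open>\<not> QuadRes (int p) g\<close> show False by blast
  qed
  ultimately show ?thesis by (intro that[of g]) (simp add: Legendre_def)
qed

text \<open>Multiplication by a nonresidue permutes the residues and changes the sign of every term,
  so the sum equals its own negative.\<close>

lemma sum_Legendre: "(\<Sum>x\<in>{0..<int p}. Legendre x (int p)) = 0"
proof -
  obtain g where g: "Legendre g (int p) = -1" by (rule nonresidue_exists)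
  then have "\<not> int p dvd g" by (auto simp: Legendre_def cong_0_iff)
  then have "(\<Sum>x\<in>{0..<int p}. Legendre (g * x) (int p)) = (\<Sum>x\<in>{0..<int p}. Legendre x (int p))"
  proof (intro sum_residues_reindex)
    fix x y assume "(g * x) mod int p = (g * y) mod int p"
    with \<open>\<not> int p dvd g\<close> show "x mod int p = y mod int p" by (rule mod_mult_cancel)
  qed (use gt2 Legendre_mod in auto)
  then show ?thesis by (simp add: Legendre_mult g sum_negf)
qed

lemma sum_Legendre_shift: "(\<Sum>x\<in>{0..<int p}. Legendre (c + x) (int p)) = 0"
proof -
  have "(\<Sum>x\<in>{0..<int p}. Legendre (c + x) (int p)) = (\<Sum>x\<in>{0..<int p}. Legendre x (int p))"
  proof (rule sum_residues_reindex)
    fix x y assume "(c + x) mod int p = (c + y) mod int p"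
    then show "x mod int p = y mod int p" by (simp add: mod_eq_dvd_iff)
  qed (use gt2 Legendre_mod in auto)
  then show ?thesis by (simp add: sum_Legendre)
qed

section \<open>Autocorrelation and second moment of the Legendre symbol\<close>

definition legendre_corr :: "int \<Rightarrow> int" where
  "legendre_corr c = (\<Sum>x\<in>{0..<int p}. Legendre x (int p) * Legendre (x + c) (int p))"

lemma legendre_corr_dvd:
  assumes "int p dvd c"
  shows "legendre_corr c = int p - 1"
proof -
  have "Legendre (x + c) (int p) = Legendre x (int p)" for x
  proof -
    have "(x + c) mod int p = x mod int p" using assms by (simp add: mod_eq_dvd_iff)
    then show ?thesis by (metis Legendre_mod)
  qed
  then have "legendre_corr c = (\<Sum>x\<in>{0..<int p}. if int p dvd x then 0 else 1)"
    by (simp add: legendre_corr_def Legendre_square)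
  also have "\<dots> = (\<Sum>x\<in>{1..<int p}. 1)"
  proof (rule sum.mono_neutral_cong_right)
    show "\<forall>x\<in>{0..<int p} - {1..<int p}. (if int p dvd x then 0 else 1) = (0::int)"
    proof
      fix x assume "x \<in> {0..<int p} - {1..<int p}"
      then have "x = 0" by auto
      then show "(if int p dvd x then 0 else 1) = (0::int)" by simp
    qed
    show "(if int p dvd x then 0 else 1) = (1::int)" if "x \<in> {1..<int p}" for x
      using that zdvd_not_zless[of x "int p"] by auto
  qed auto
  finally show ?thesis using gt2 by simp
qed

text \<open>The substitution of \<open>c * x\<close> for \<open>x\<close> pulls the square of the
  symbol of \<open>c\<close>, which is 1, out of every term.\<close>

lemma legendre_corr_not_dvd_eq:
  assumes "\<not> int p dvd c"
  shows "legendre_corr c = legendre_corr 1"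
proof -
  let ?f = "\<lambda>x. Legendre x (int p) * Legendre (x + c) (int p)"
  have "(\<Sum>x\<in>{0..<int p}. ?f (c * x)) = (\<Sum>x\<in>{0..<int p}. ?f x)"
  proof (rule sum_residues_reindex[OF _ _ mod_mult_cancel[OF assms]])
    fix x show "?f (x mod int p) = ?f x"
      using Legendre_mod[of "x mod int p + c"] Legendre_mod[of "x + c"] Legendre_mod[of x]
      by (simp add: mod_add_left_eq)
  qed (use gt2 in auto)
  moreover have "?f (c * x) = Legendre x (int p) * Legendre (x + 1) (int p)" for x
  proof -
    have "?f (c * x) = Legendre (c * x) (int p) * Legendre (c * (x + 1)) (int p)"
      by (simp add: distrib_left)
    also have "\<dots> = (Legendre c (int p) * Legendre c (int p)) * (Legendre x (int p) * Legendre (x + 1) (int p))"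
      unfolding Legendre_mult by simp
    finally show ?thesis using assms by (simp add: Legendre_square)
  qed
  ultimately show ?thesis by (simp add: legendre_corr_def)
qed

text \<open>Summed over all shifts the correlations vanish. Shift 0 contributes
  \<open>p - 1\<close>, and the \<open>p - 1\<close> other shifts contribute equal amounts, so each
  contributes -1.\<close>

lemma legendre_corr_not_dvd:
  assumes "\<not> int p dvd c"
  shows "legendre_corr c = -1"
proof -
  have "(\<Sum>c\<in>{0..<int p}. legendre_corr c)
      = (\<Sum>x\<in>{0..<int p}. Legendre x (int p) * (\<Sum>c\<in>{0..<int p}. Legendre (x + c) (int p)))"
    unfolding legendre_corr_def sum_distrib_left by (rule sum.swap)
  then have "(\<Sum>c\<in>{0..<int p}. legendre_corr c) = 0" by (simp add: sum_Legendre_shift)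
  moreover have "{0..<int p} = insert 0 {1..<int p}" using gt2 by auto
  moreover have "(\<Sum>c\<in>{1..<int p}. legendre_corr c) = (\<Sum>c\<in>{1..<int p}. legendre_corr 1)"
    using zdvd_not_zless[of _ "int p"] by (intro sum.cong legendre_corr_not_dvd_eq) auto
  ultimately have "(int p - 1) * (1 + legendre_corr 1) = 0"
    using gt2 by (simp add: legendre_corr_dvd algebra_simps)
  then show ?thesis using gt2 legendre_corr_not_dvd_eq[OF assms] by simp
qed

text \<open>Expanding the square leaves correlations at the shifts \<open>b' - b\<close>:
  \<open>p - 1\<close> on the diagonal and -1 off it.\<close>

lemma sum_Legendre_set_square:
  assumes "B \<subseteq> {0..<int p}"
  shows "(\<Sum>x\<in>{0..<int p}. (\<Sum>b\<in>B. Legendre (x + b) (int p))\<^sup>2) = int p * card B - (int (card B))\<^sup>2"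
proof -
  let ?L = "\<lambda>x. Legendre x (int p)"
  have fin: "finite B" using assms by (rule finite_subset) simp
  have corr: "(\<Sum>x\<in>{0..<int p}. ?L (x + b) * ?L (x + b')) = (if b' = b then int p - 1 else -1)"
    if "b \<in> B" "b' \<in> B" for b b'
  proof -
    let ?f = "\<lambda>x. ?L x * ?L (x + (b' - b))"
    have "(\<Sum>x\<in>{0..<int p}. ?f (x + b)) = (\<Sum>x\<in>{0..<int p}. ?f x)"
    proof (rule sum_residues_reindex)
      fix x show "?f (x mod int p) = ?f x"
        using Legendre_mod[of "x mod int p + (b' - b)"] Legendre_mod[of "x + (b' - b)"] Legendre_mod[of x]
        by (simp add: mod_add_left_eq)
    next
      fix x y assume "(x + b) mod int p = (y + b) mod int p"
      then show "x mod int p = y mod int p" by (simp add: mod_eq_dvd_iff)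
    qed (use gt2 in auto)
    then have "(\<Sum>x\<in>{0..<int p}. ?L (x + b) * ?L (x + b')) = legendre_corr (b' - b)"
      by (simp add: legendre_corr_def)
    moreover have "int p dvd b' - b \<longleftrightarrow> b' = b"
    proof -
      have "b mod int p = b" "b' mod int p = b'" using that assms by (auto simp: subset_iff)
      then show ?thesis using mod_eq_dvd_iff[of b' "int p" b] by simp
    qed
    ultimately show ?thesis by (simp add: legendre_corr_dvd legendre_corr_not_dvd)
  qed
  have "(\<Sum>x\<in>{0..<int p}. (\<Sum>b\<in>B. ?L (x + b))\<^sup>2)
      = (\<Sum>x\<in>{0..<int p}. \<Sum>b\<in>B. \<Sum>b'\<in>B. ?L (x + b) * ?L (x + b'))"
    by (simp add: power2_eq_square sum_product)
  also have "\<dots> = (\<Sum>b\<in>B. \<Sum>x\<in>{0..<int p}. \<Sum>b'\<in>B. ?L (x + b) * ?L (x + b'))"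
    by (rule sum.swap)
  also have "\<dots> = (\<Sum>b\<in>B. \<Sum>b'\<in>B. \<Sum>x\<in>{0..<int p}. ?L (x + b) * ?L (x + b'))"
    by (intro sum.cong refl sum.swap)
  also have "\<dots> = (\<Sum>b\<in>B. \<Sum>b'\<in>B. if b' = b then int p - 1 else -1)"
    by (intro sum.cong refl corr)
  also have "\<dots> = (\<Sum>b\<in>B. int p - int (card B))"
  proof (rule sum.cong[OF refl])
    fix b assume b: "b \<in> B"
    have "(\<Sum>b'\<in>B. if b' = b then int p - 1 else -1) = (\<Sum>b'\<in>B. (if b' = b then int p else 0) - 1)"
      by (intro sum.cong) auto
    also have "\<dots> = int p - int (card B)" using b fin by (simp add: sum_subtractf)
    finally show "(\<Sum>b'\<in>B. if b' = b then int p - 1 else -1) = int p - int (card B)" .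
  qed
  also have "\<dots> = int p * card B - (int (card B))\<^sup>2" by (simp add: power2_eq_square algebra_simps)
  finally show ?thesis .
qed

text \<open>Let \<open>n = card B\<close>. For \<open>a\<close> in \<open>A\<close> every symbol of
  \<open>a + b\<close> is 1, except for at most one \<open>b\<close> where it is 0, so the inner sum
  is at least \<open>n - 1\<close>. The second moment gives
  \<open>card A * (n - 1)^2 \<le> n * (p - n)\<close>, and \<open>n \<le> card A\<close> allows
  \<open>n\<close> to be cancelled.\<close>

lemma card_le_of_sumset_QuadRes:
  assumes A: "A \<subseteq> {0..<int p}" and B: "B \<subseteq> {0..<int p}" and "card B \<le> card A"
    and QR: "\<And>a b. a \<in> A \<Longrightarrow> b \<in> B \<Longrightarrow> QuadRes (int p) (a + b)"
  shows "real (card B) \<le> sqrt (real p) + 1"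
proof (cases "card B = 0")
  case False
  let ?n = "int (card B)"
  have fin: "finite A" "finite B" using A B by (auto intro: finite_subset)
  have row: "(?n - 1)\<^sup>2 \<le> (\<Sum>b\<in>B. Legendre (a + b) (int p))\<^sup>2" if a: "a \<in> A" for a
  proof -
    let ?Z = "{b \<in> B. int p dvd a + b}"
    have "card ?Z \<le> 1"
    proof (subst card_le_Suc0_iff_eq[folded One_nat_def])
      show "\<forall>x\<in>?Z. \<forall>y\<in>?Z. x = y"
      proof (intro ballI)
        fix x y assume xy: "x \<in> ?Z" "y \<in> ?Z"
        then have "int p dvd (a + x) - (a + y)" by (intro dvd_diff) auto
        then have "x mod int p = y mod int p" by (simp add: mod_eq_dvd_iff)
        then show "x = y" using xy B by (auto simp: subset_iff)
      qed
    qed (use fin in auto)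
    moreover have "(\<Sum>b\<in>B. Legendre (a + b) (int p)) = (\<Sum>b\<in>B. 1 - (if int p dvd a + b then 1 else 0))"
      using QR[OF a] by (intro sum.cong) (auto simp: Legendre_def cong_0_iff)
    moreover have "\<dots> = ?n - card ?Z" using fin by (simp add: sum_subtractf sum.If_cases Int_def)
    ultimately have "?n - 1 \<le> (\<Sum>b\<in>B. Legendre (a + b) (int p))" by simp
    then show ?thesis using False by (intro power_mono) auto
  qed
  have "?n * (?n - 1)\<^sup>2 \<le> int (card A) * (?n - 1)\<^sup>2"
    using assms(3) by (intro mult_right_mono) auto
  also have "\<dots> \<le> (\<Sum>a\<in>A. (\<Sum>b\<in>B. Legendre (a + b) (int p))\<^sup>2)"
    using sum_mono[OF row, of A] by simp
  also have "\<dots> \<le> (\<Sum>x\<in>{0..<int p}. (\<Sum>b\<in>B. Legendre (x + b) (int p))\<^sup>2)"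
    using A by (intro sum_mono2) auto
  also have "\<dots> = ?n * (int p - ?n)"
    unfolding sum_Legendre_set_square[OF B] by (simp add: power2_eq_square algebra_simps)
  finally have "(?n - 1)\<^sup>2 \<le> int p - ?n" using False by (simp add: mult_le_cancel_left)
  then have "(?n - 1)\<^sup>2 \<le> int p" by simp
  then have "real_of_int ((?n - 1)\<^sup>2) \<le> real_of_int (int p)" by (simp only: of_int_le_iff)
  then have "(real (card B) - 1)\<^sup>2 \<le> real p" by simp
  then have "real (card B) - 1 \<le> sqrt (real p)" by (rule real_le_rsqrt)
  then show ?thesis by simp
qed auto

text \<open>The previous bound holds for the smaller of the two sets, and which one that is may vary
  with \<open>p\<close>. Adding the reciprocals gives a symmetric statement that can be summed over
  primes and sieved separately for each set.\<close>

lemma inverse_cards_ge_of_sumset_QuadRes: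
  assumes A: "A \<subseteq> {0..<int p}" "A \<noteq> {}" and B: "B \<subseteq> {0..<int p}" "B \<noteq> {}"
    and QR: "\<And>a b. a \<in> A \<Longrightarrow> b \<in> B \<Longrightarrow> QuadRes (int p) (a + b)"
  shows "1 / (sqrt (real p) + 1) \<le> 1 / real (card A) + 1 / real (card B)"
proof -
  have "finite A" "finite B" using A B by (auto intro: finite_subset)
  then have pos: "card A > 0" "card B > 0" using A B by (auto simp: card_gt_0_iff)
  show ?thesis
  proof (cases "card B \<le> card A")
    case True
    then have "real (card B) \<le> sqrt (real p) + 1"
      using card_le_of_sumset_QuadRes[OF A(1) B(1)] QR by blast
    then have "1 / (sqrt (real p) + 1) \<le> 1 / real (card B)"
      using pos by (intro divide_left_mono) auto
    then show ?thesis by (simp add: add_increasing)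
  next
    case False
    then have "real (card A) \<le> sqrt (real p) + 1"
    proof (intro card_le_of_sumset_QuadRes[OF B(1) A(1)])
      fix b a assume "b \<in> B" "a \<in> A"
      then show "QuadRes (int p) (b + a)" using QR[of a b] by (simp add: add.commute)
    qed simp
    then have "1 / (sqrt (real p) + 1) \<le> 1 / real (card A)"
      using pos by (intro divide_left_mono) auto
    then show ?thesis by (simp add: add_increasing2)
  qed
qed

end

subsection \<open>The larger sieve\<close>

lemma two_power_card_prime_factors_le:
  fixes n :: nat
  assumes "n > 0"
  shows "2 ^ card (prime_factors n) \<le> n"
proof -
  have "2 ^ card (prime_factors n) = (\<Prod>p\<in>prime_factors n. 2)" by simp
  also have "\<dots> \<le> (\<Prod>p\<in>prime_factors n. p ^ multiplicity p n)"
  proof (rule prod_mono, safe)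
    fix p assume p: "p \<in> prime_factors n"
    then have "2 \<le> p" by (simp add: in_prime_factors_imp_prime prime_ge_2_nat)
    also have "p \<le> p ^ multiplicity p n"
      using p \<open>2 \<le> p\<close> by (intro self_le_power) (auto simp: prime_factors_multiplicity)
    finally show "2 \<le> p ^ multiplicity p n" .
  qed
  also have "\<dots> = n" using assms by (simp add: prime_factorization_nat[symmetric])
  finally show ?thesis .
qed

lemma card_prime_divisors_le_log:
  fixes t :: int and P :: "nat set"
  assumes "\<And>p. p \<in> P \<Longrightarrow> prime p" "t \<noteq> 0" "\<bar>t\<bar> \<le> N"
  shows "real (card {p \<in> P. int p dvd t}) \<le> log 2 N"
proof -
  define n where "n = nat \<bar>t\<bar>"
  have n: "n > 0" "int n = \<bar>t\<bar>" using assms(2) by (auto simp: n_def)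
  have "{p \<in> P. int p dvd t} \<subseteq> prime_factors n"
  proof safe
    fix p assume "p \<in> P" "int p dvd t"
    then have "int p dvd int n" using n(2) by simp
    then show "p \<in> prime_factors n" using n(1) assms(1)[OF \<open>p \<in> P\<close>] by (auto simp: prime_factors_dvd)
  qed
  then have "card {p \<in> P. int p dvd t} \<le> card (prime_factors n)" by (intro card_mono) auto
  then have "(2::nat) ^ card {p \<in> P. int p dvd t} \<le> 2 ^ card (prime_factors n)" by simp
  also have "\<dots> \<le> n" using n(1) by (rule two_power_card_prime_factors_le)
  finally have "real (2 ^ card {p \<in> P. int p dvd t}) \<le> real n" by (simp only: of_nat_le_iff)
  then have "2 powr real (card {p \<in> P. int p dvd t}) \<le> real n" by (simp add: powr_realpow)
  also have "real n \<le> real_of_int N" using n(2) assms(3) by linarith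
  finally have "2 powr real (card {p \<in> P. int p dvd t}) \<le> real_of_int N" .
  moreover have "real_of_int N > 0" using n assms(3) by linarith
  ultimately show ?thesis by (simp add: le_log_iff)
qed

text \<open>Cauchy-Schwarz over the residue classes met by \<open>X\<close>: the congruent pairs
  number the sum of the squared class sizes.\<close>

lemma card_square_le_congruent_pairs:
  fixes X :: "int set" and m :: int
  assumes "finite X"
  shows "(real (card X))\<^sup>2 \<le>
    real (card ((\<lambda>x. x mod m) ` X)) * real (card {z \<in> X \<times> X. m dvd fst z - snd z})"
proof -
  let ?I = "(\<lambda>x. x mod m) ` X"
  define F where "F r = {x \<in> X. x mod m = r}" for r
  have finF: "finite (F r)" for r using assms by (simp add: F_def)
  have "X = (\<Union>r\<in>?I. F r)" by (auto simp: F_def)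
  also have "card \<dots> = (\<Sum>r\<in>?I. card (F r))"
    using assms by (intro card_UN_disjoint) (auto simp: F_def)
  finally have 1: "card X = (\<Sum>r\<in>?I. card (F r))" .
  have "{z \<in> X \<times> X. m dvd fst z - snd z} = (\<Union>r\<in>?I. F r \<times> F r)"
    by (auto simp: F_def simp flip: mod_eq_dvd_iff)
  also have "card \<dots> = (\<Sum>r\<in>?I. card (F r \<times> F r))"
    using assms by (intro card_UN_disjoint) (auto simp: F_def)
  finally have 2: "card {z \<in> X \<times> X. m dvd fst z - snd z} = (\<Sum>r\<in>?I. (card (F r))\<^sup>2)"
    by (simp add: card_cartesian_product power2_eq_square)
  have "(real (card X))\<^sup>2 = (\<Sum>r\<in>?I. real (card (F r)))\<^sup>2" by (simp add: 1)
  also have "\<dots> \<le> (\<Sum>r\<in>?I. (real (card (F r)))\<^sup>2) * card ?I"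
    by (rule sum_squared_le_sum_of_squares)
  also have "\<dots> = card ?I * real (card {z \<in> X \<times> X. m dvd fst z - snd z})"
    by (simp add: 2)
  finally show ?thesis .
qed

text \<open>Gallagher's larger sieve with every prime given weight 1 instead of \<open>ln p\<close>.\<close>
lemma larger_sieve_unweighted:
  fixes X :: "int set" and P :: "nat set" and N :: int
  assumes "finite X" "X \<noteq> {}" "finite P" "\<And>p. p \<in> P \<Longrightarrow> prime p" "N \<ge> 1"
    and diff: "\<And>x y. x \<in> X \<Longrightarrow> y \<in> X \<Longrightarrow> \<bar>x - y\<bar> \<le> N"
  shows "(\<Sum>p\<in>P. 1 / real (card ((\<lambda>x. x mod int p) ` X))) \<le> card P / card X + log 2 N"
proof -
  let ?n = "real (card X)"
  define C where "C p = card {z \<in> X \<times> X. int p dvd fst z - snd z}" for p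
  have npos: "?n > 0" using assms by (simp add: card_gt_0_iff)
  have logN: "log 2 N \<ge> 0" using assms(5) by simp
  have each: "?n\<^sup>2 * (1 / real (card ((\<lambda>x. x mod int p) ` X))) \<le> real (C p)" for p
  proof -
    have "card ((\<lambda>x. x mod int p) ` X) > 0" using assms by (simp add: card_gt_0_iff)
    then show ?thesis using card_square_le_congruent_pairs[OF assms(1), of "int p"]
      by (simp add: C_def field_simps)
  qed
  have "?n\<^sup>2 * (\<Sum>p\<in>P. 1 / real (card ((\<lambda>x. x mod int p) ` X))) \<le> (\<Sum>p\<in>P. real (C p))"
    unfolding sum_distrib_left by (intro sum_mono each)
  also have "\<dots> = (\<Sum>p\<in>P. \<Sum>z\<in>X \<times> X. if int p dvd fst z - snd z then 1 else 0)"
    using assms(1) by (simp add: C_def sum.If_cases Int_def)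
  also have "\<dots> = (\<Sum>z\<in>X \<times> X. \<Sum>p\<in>P. if int p dvd fst z - snd z then 1 else 0)"
    by (rule sum.swap)
  also have "\<dots> = (\<Sum>z\<in>X \<times> X. real (card {p \<in> P. int p dvd fst z - snd z}))"
    using assms(3) by (simp add: sum.If_cases Int_def)
  \<comment> \<open>A diagonal pair has difference 0, divisible by every prime of \<open>P\<close>;
    a nonzero difference has at most \<open>log 2 N\<close> prime divisors.\<close>
  also have "\<dots> \<le> (\<Sum>z\<in>X \<times> X. (if snd z = fst z then real (card P) else 0) + log 2 N)"
  proof (rule sum_mono)
    fix z assume z: "z \<in> X \<times> X"
    show "real (card {p \<in> P. int p dvd fst z - snd z}) \<le> (if snd z = fst z then real (card P) else 0) + log 2 N"
    proof (cases "fst z = snd z")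
      case True
      then show ?thesis using logN by simp
    next
      case False
      then show ?thesis
        using card_prime_divisors_le_log[OF assms(4), of P "fst z - snd z" N] diff[of "fst z" "snd z"] z
        by (auto simp: mem_Times_iff)
    qed
  qed
  also have "\<dots> = (\<Sum>x\<in>X. \<Sum>y\<in>X. if y = x then real (card P) else 0) + ?n\<^sup>2 * log 2 N"
    unfolding sum.distrib sum.cartesian_product
    by (simp add: card_cartesian_product power2_eq_square split_beta)
  also have "(\<Sum>x\<in>X. \<Sum>y\<in>X. if y = x then real (card P) else 0) = ?n * card P"
    using assms(1) by simp
  finally have "?n\<^sup>2 * (\<Sum>p\<in>P. 1 / real (card ((\<lambda>x. x mod int p) ` X))) \<le> ?n * card P + ?n\<^sup>2 * log 2 N" .
  also have "\<dots> = ?n\<^sup>2 * (card P / ?n + log 2 N)"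
    using npos by (simp add: power2_eq_square algebra_simps)
  finally show ?thesis using npos by simp
qed

subsection \<open>A lower bound for the number of primes\<close>

text \<open>Induction on \<open>k\<close> along Leibniz' harmonic triangle: with \<open>T m k = (m + 1) * (m choose k)\<close>,
  \<open>1 / T (m + 1) (k + 1) = 1 / T m k - 1 / T (m + 1) k\<close>.\<close>
lemma Suc_times_binomial_dvd_common_multiple:
  fixes L M m k :: nat
  assumes "\<And>j. j \<in> {1..M} \<Longrightarrow> j dvd L" "m < M" "k \<le> m"
  shows "Suc m * (m choose k) dvd L"
proof -
  define T where "T m k = real (Suc m) * real (m choose k)" for m k
  \<comment> \<open>Divisibility is stated as integrality of a real quotient, because integrality
    passes through the difference in the recurrence.\<close>
  have "real L / T m k \<in> \<int>"
    using assms(2,3)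
  proof (induction k arbitrary: m)
    case 0
    then have "Suc m dvd L" using assms(1)[of "Suc m"] by simp
    then obtain q where "L = Suc m * q" by blast
    then have "real L = real (Suc m) * real q" by (simp only: of_nat_mult)
    then have "real L / T m 0 = real q" by (simp add: T_def del: of_nat_Suc)
    then show ?case by simp
  next
    case (Suc k)
    obtain n where n: "m = Suc n" using Suc.prems by (cases m) auto
    define c where "c = real (n choose k)"
    have c: "c > 0" using Suc.prems n by (simp add: c_def)
    have "(real k + 1) * real (m choose Suc k) = (real n + 1) * c"
      using Suc_times_binomial[of k n] unfolding n c_def
      by (metis of_nat_Suc of_nat_mult add.commute)
    \<comment> \<open>All three entries are expressed through \<open>c\<close> over the common
      denominator \<open>D\<close>; the recurrence then reads
      \<open>k + 1 = (n + 2) - (n + 1 - k)\<close>.\<close>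
    then have T1: "real (m choose Suc k) = (real n + 1) * c / (real k + 1)"
      by (simp add: field_simps)
    have "real (m - k) * real (m choose k) = real m * c"
      using binomial_absorb_comp[of m k] unfolding n c_def
      by (metis diff_Suc_1 of_nat_mult)
    then have T2: "real (m choose k) = (real n + 1) * c / (real n + 1 - real k)"
      using Suc.prems n by (simp add: field_simps of_nat_diff)
    define D where "D = (real n + 2) * ((real n + 1) * c)"
    have D: "D > 0" using c by (simp add: D_def)
    have "1 / T m (Suc k) = (real k + 1) / D"
      unfolding T_def T1 D_def by (simp add: n)
    moreover have "1 / T m k = (real n + 1 - real k) / D"
      unfolding T_def T2 D_def by (simp add: n)
    moreover have "1 / T n k = (real n + 2) / D"
      using c by (simp add: T_def D_def c_def[symmetric] add.commute)
    ultimately have "1 / T m (Suc k) = 1 / T n k - 1 / T m k"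
      by (simp flip: diff_divide_distrib)
    then have "real L / T m (Suc k) = real L / T n k - real L / T m k"
      by (metis right_diff_distrib times_divide_eq_right mult.right_neutral)
    moreover have "real L / T n k \<in> \<int>" "real L / T m k \<in> \<int>"
      using Suc.IH Suc.prems n by auto
    ultimately show ?case by simp
  qed
  then obtain z where "real L / T m k = of_int z" by (auto elim: Ints_cases)
  moreover have "T m k > 0" using assms(3) by (simp add: T_def)
  ultimately have "real L = of_int z * T m k" by (simp add: field_simps)
  then have "real_of_int (int L) = real_of_int (z * int (Suc m * (m choose k)))"
    by (simp add: T_def algebra_simps)
  then have "int L = z * int (Suc m * (m choose k))" by (simp only: of_int_eq_iff)
  then have "int (Suc m * (m choose k)) dvd int L" by simp
  then show ?thesis by (simp only: of_nat_dvd_iff)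
qed

section \<open>The least common multiple of 1, ..., M and the count of primes\<close>

lemma prime_power_dvd_lcm_nat:
  fixes a b p :: nat
  assumes "prime p" "a \<noteq> 0" "b \<noteq> 0" "p ^ k dvd lcm a b"
  shows "p ^ k dvd a \<or> p ^ k dvd b"
proof -
  have "multiplicity p (lcm a b) = max (multiplicity p a) (multiplicity p b)"
    using assms by (simp flip: count_prime_factorization_prime add: prime_factorization_lcm)
  moreover have "k \<le> multiplicity p (lcm a b)"
    using assms by (intro multiplicity_geI) auto
  ultimately have "k \<le> multiplicity p a \<or> k \<le> multiplicity p b" by (simp add: le_max_iff_disj)
  then show ?thesis by (auto intro: multiplicity_dvd')
qed

lemma prime_power_dvd_Lcm_upto:
  fixes p M :: nat
  assumes "prime p" "k > 0" "p ^ k dvd Lcm {1..M}"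
  shows "p ^ k \<le> M"
  using assms(3)
proof (induction M)
  case 0
  then show ?case using assms by (simp add: prime_nat_iff)
next
  case (Suc M)
  have "{1..Suc M} = insert (Suc M) {1..M}" by auto
  then have "p ^ k dvd lcm (Suc M) (Lcm {1..M})" using Suc.prems by simp
  then have "p ^ k dvd Suc M \<or> p ^ k dvd Lcm {1..M}"
    using assms(1) by (intro prime_power_dvd_lcm_nat) (auto simp: Lcm_0_iff)
  then show ?case using Suc.IH by (auto dest: dvd_imp_le)
qed

text \<open>Each prime power in the factorisation of the lcm divides one of the numbers up to
  \<open>M\<close>, so it is at most \<open>M\<close>, and there is one such factor for each prime
  up to \<open>M\<close> at most.\<close>

lemma Lcm_upto_le:
  fixes M :: nat
  shows "Lcm {1..M} \<le> M ^ card {p. prime p \<and> p \<le> M}"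
proof (cases "M = 0")
  case True
  then have "{p. prime p \<and> p \<le> M} = {}" using prime_gt_0_nat by auto
  with True show ?thesis by (simp only: card.empty) simp
next
  case False
  let ?L = "Lcm {1..M}"
  have L: "?L > 0" by (simp add: Lcm_0_iff flip: neq0_conv)
  have le: "p ^ multiplicity p ?L \<le> M" if "p \<in> prime_factors ?L" for p
    using that by (intro prime_power_dvd_Lcm_upto) (auto simp: multiplicity_dvd prime_factors_multiplicity)
  have "prime_factors ?L \<subseteq> {p. prime p \<and> p \<le> M}"
  proof safe
    fix p assume p: "p \<in> prime_factors ?L"
    then show "prime p" by auto
    have "p \<le> p ^ multiplicity p ?L"
      using p prime_gt_0_nat by (intro self_le_power) (auto simp: prime_factors_multiplicity Suc_le_eq)
    with le[OF p] show "p \<le> M" by simp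
  qed
  then have card: "card (prime_factors ?L) \<le> card {p. prime p \<and> p \<le> M}"
    by (intro card_mono) (auto intro: finite_subset[of _ "{..M}"])
  have "?L = (\<Prod>p\<in>prime_factors ?L. p ^ multiplicity p ?L)"
    by (rule prime_factorization_nat[OF L])
  also have "\<dots> \<le> (\<Prod>p\<in>prime_factors ?L. M)"
    using le by (intro prod_mono) (simp del: One_nat_def)
  also have "\<dots> = M ^ card (prime_factors ?L)" by simp
  also have "\<dots> \<le> M ^ card {p. prime p \<and> p \<le> M}"
    using card False by (intro power_increasing) auto
  finally show ?thesis .
qed

text \<open>\<open>(2 * n + 1) * (2 * n choose n)\<close> is at least \<open>4 ^ n\<close> and
  divides the lcm of the numbers up to \<open>2 * n + 1\<close>, which is bounded through the prime
  count; then logarithms are taken.\<close>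

lemma Chebyshev_prime_count_lower_bound:
  fixes n :: nat
  assumes "n > 0"
  shows "real n * ln 4 \<le> real (card {p. prime p \<and> p \<le> 2 * n + 1}) * ln (real (2 * n + 1))"
proof -
  let ?M = "2 * n + 1"
  let ?c = "card {p. prime p \<and> p \<le> ?M}"
  have "Suc (2 * n) * (2 * n choose n) dvd Lcm {1..?M}"
    by (rule Suc_times_binomial_dvd_common_multiple[where M = ?M]) auto
  then have "Suc (2 * n) * (2 * n choose n) \<le> Lcm {1..?M}"
    by (rule dvd_imp_le) (simp add: Lcm_0_iff flip: neq0_conv)
  also have "\<dots> \<le> ?M ^ ?c" by (rule Lcm_upto_le)
  finally have "real (Suc (2 * n) * (2 * n choose n)) \<le> real (?M ^ ?c)" by (simp only: of_nat_le_iff)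
  then have le: "real (Suc (2 * n)) * real (2 * n choose n) \<le> real ?M ^ ?c"
    by (simp only: of_nat_mult of_nat_power)
  have "4 ^ n / (2 * real n) \<le> real (2 * n choose n)" by (rule central_binomial_lower_bound[OF assms])
  then have "4 ^ n \<le> (2 * real n) * real (2 * n choose n)" using assms by (simp add: field_simps)
  also have "\<dots> \<le> real (Suc (2 * n)) * real (2 * n choose n)" by (intro mult_right_mono) auto
  also note le
  finally have "ln (4 ^ n) \<le> ln (real ?M ^ ?c)" by (subst ln_le_cancel_iff) auto
  then show ?thesis using assms by (simp add: ln_realpow)
qed

subsection \<open>Hilbert cubes in the squares\<close>

text \<open>The reciprocal inequality, weakened from \<open>sqrt p\<close> to \<open>sqrt Q\<close>,
  is summed over the \<open>k\<close> odd primes up to \<open>Q\<close>; the larger sieve bounds the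
  two resulting sums.\<close>

lemma sumset_squares_sieve:
  fixes X Y :: "int set" and N :: int and Q :: nat and M :: real
  defines "k \<equiv> real (card {p. prime p \<and> 2 < p \<and> p \<le> Q})"
  assumes X: "finite X" "\<And>x x'. x \<in> X \<Longrightarrow> x' \<in> X \<Longrightarrow> \<bar>x - x'\<bar> \<le> N"
    and Y: "finite Y" "\<And>y y'. y \<in> Y \<Longrightarrow> y' \<in> Y \<Longrightarrow> \<bar>y - y'\<bar> \<le> N"
    and "N \<ge> 1" "M > 0" "M \<le> card X" "M \<le> card Y"
    and sq: "\<And>x y. x \<in> X \<Longrightarrow> y \<in> Y \<Longrightarrow> \<exists>n. x + y = n\<^sup>2"
  shows "k / (sqrt (real Q) + 1) \<le> 2 * k / M + 2 * log 2 N"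
proof -
  let ?P = "{p. prime p \<and> 2 < p \<and> p \<le> Q}"
  let ?res = "\<lambda>p Z. (\<lambda>z. z mod int p) ` Z"
  have finP: "finite ?P" by (rule finite_subset[of _ "{..Q}"]) auto
  have k0: "k \<ge> 0" by (simp add: k_def)
  have ne: "X \<noteq> {}" "Y \<noteq> {}" using assms(7-9) by auto
  have "1 / (sqrt (real Q) + 1) \<le> 1 / real (card (?res p X)) + 1 / real (card (?res p Y))"
    if "p \<in> ?P" for p
  proof -
    have p: "prime p" "2 < p" "p \<le> Q" using that by auto
    have "1 / (sqrt (real Q) + 1) \<le> 1 / (sqrt (real p) + 1)"
      using p by (intro divide_left_mono) (auto simp: add_nonneg_pos)
    also have "\<dots> \<le> 1 / real (card (?res p X)) + 1 / real (card (?res p Y))"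
    proof (rule inverse_cards_ge_of_sumset_QuadRes[OF p(1,2)])
      fix a b assume "a \<in> ?res p X" "b \<in> ?res p Y"
      then obtain x y where xy: "x \<in> X" "y \<in> Y" "a = x mod int p" "b = y mod int p" by blast
      obtain n where "x + y = n\<^sup>2" using sq xy by blast
      then have "[n\<^sup>2 = a + b] (mod int p)" by (simp only: cong_def xy mod_add_eq)
      then show "QuadRes (int p) (a + b)" unfolding QuadRes_def by blast
    qed (use p ne in auto)
    finally show ?thesis .
  qed
  then have "(\<Sum>p\<in>?P. 1 / (sqrt (real Q) + 1)) \<le>
      (\<Sum>p\<in>?P. 1 / real (card (?res p X)) + 1 / real (card (?res p Y)))"
    by (rule sum_mono)
  also have "\<dots> = (\<Sum>p\<in>?P. 1 / real (card (?res p X))) + (\<Sum>p\<in>?P. 1 / real (card (?res p Y)))"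
    by (rule sum.distrib)
  also have "\<dots> \<le> (k / card X + log 2 N) + (k / card Y + log 2 N)"
  proof (intro add_mono)
    show "(\<Sum>p\<in>?P. 1 / real (card (?res p X))) \<le> k / card X + log 2 N"
      unfolding k_def by (rule larger_sieve_unweighted[OF X(1) ne(1) finP _ \<open>N \<ge> 1\<close> X(2)]) simp_all
    show "(\<Sum>p\<in>?P. 1 / real (card (?res p Y))) \<le> k / card Y + log 2 N"
      unfolding k_def by (rule larger_sieve_unweighted[OF Y(1) ne(2) finP _ \<open>N \<ge> 1\<close> Y(2)]) simp_all
  qed
  also have "\<dots> \<le> (k / M + log 2 N) + (k / M + log 2 N)"
  proof -
    have "k / card X \<le> k / M" "k / card Y \<le> k / M"
      using assms(7-9) k0 by (simp_all add: frac_le)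
    then show ?thesis by simp
  qed
  finally show ?thesis by (simp add: k_def)
qed

text \<open>The sieve is run with \<open>Q = 2 * n + 1\<close>. By Chebyshev's bound the last
  premise provides so many odd primes that the term \<open>2 * log 2 N\<close> takes up at most half
  of \<open>k / s\<close>. The other half is at most \<open>2 * k / M\<close>, and \<open>k\<close>
  cancels.\<close>

lemma sumset_squares_bound:
  fixes X Y :: "int set" and N :: int and n :: nat and M :: real
  assumes X: "finite X" "\<And>x x'. x \<in> X \<Longrightarrow> x' \<in> X \<Longrightarrow> \<bar>x - x'\<bar> \<le> N"
    and Y: "finite Y" "\<And>y y'. y \<in> Y \<Longrightarrow> y' \<in> Y \<Longrightarrow> \<bar>y - y'\<bar> \<le> N"
    and "N \<ge> 2" "M > 0" "M \<le> card X" "M \<le> card Y"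
    and sq: "\<And>x y. x \<in> X \<Longrightarrow> y \<in> Y \<Longrightarrow> \<exists>n. x + y = n\<^sup>2"
    and n: "n > 0" "4 * log 2 N * (sqrt (2 * real n + 1) + 1) \<le> real n * ln 4 / ln (2 * real n + 1) - 1"
  shows "M \<le> 4 * (sqrt (2 * real n + 1) + 1)"
proof -
  define k where "k = real (card {p. prime p \<and> 2 < p \<and> p \<le> 2 * n + 1})"
  define s where "s = sqrt (real (2 * n + 1)) + 1"
  have s: "s > 0" by (simp add: s_def add_nonneg_pos)
  have logN: "log 2 N > 0" using \<open>N \<ge> 2\<close> by simp
  \<comment> \<open>The prime 2 is discarded here; this is the \<open>- 1\<close> in the premise on
    \<open>n\<close>.\<close>
  have "{p::nat. prime p \<and> p \<le> 2 * n + 1} \<subseteq> insert 2 {p. prime p \<and> 2 < p \<and> p \<le> 2 * n + 1}"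
    by (auto dest: prime_ge_2_nat)
  then have "card {p::nat. prime p \<and> p \<le> 2 * n + 1} \<le> card (insert 2 {p. prime p \<and> 2 < p \<and> p \<le> 2 * n + 1})"
    by (intro card_mono) (auto intro: finite_subset[of _ "{..2 * n + 1}"])
  also have "\<dots> \<le> Suc (card {p. prime p \<and> 2 < p \<and> p \<le> 2 * n + 1})" by (rule card_insert_le_m1) auto
  finally have "real (card {p::nat. prime p \<and> p \<le> 2 * n + 1}) \<le> k + 1" by (simp add: k_def)
  moreover have lnpos: "ln (real (2 * n + 1)) > 0" using n(1) by simp
  ultimately have "real n * ln 4 \<le> (k + 1) * ln (real (2 * n + 1))"
    using Chebyshev_prime_count_lower_bound[OF n(1)] by (meson mult_right_mono order.trans less_imp_le)
  then have "n * ln 4 / ln (real (2 * n + 1)) - 1 \<le> k" using lnpos by (simp add: field_simps)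
  with n(2) have k: "4 * log 2 N * s \<le> k" by (simp add: s_def add.commute)
  have main: "k / s \<le> 2 * k / M + 2 * log 2 N"
    unfolding k_def s_def using \<open>N \<ge> 2\<close> by (intro sumset_squares_sieve[OF X Y _ assms(6-8) sq]) simp_all
  have "2 * log 2 N \<le> k / (2 * s)" using k s by (simp add: field_simps)
  moreover have "k / s = k / (2 * s) + k / (2 * s)" using s by simp
  ultimately have "k / (2 * s) \<le> 2 * k / M" using main by linarith
  moreover have "0 < 4 * log 2 N * s" using s logN by simp
  then have "k > 0" using k by linarith
  ultimately have "M \<le> 4 * s" using s \<open>M > 0\<close> by (simp add: field_simps)
  then show ?thesis by (simp add: s_def add.commute)
qed

text \<open>Four decimals suffice: \<open>2.006 / 0.2876\<close> is still below 7.\<close>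

lemma ln_four_thirds: "ln (4/3 :: real) \<ge> 2876 / 10000"
  using ln_approx_bounds[of "4/3" 2] by (simp add: eval_nat_numeral)

lemma subset_sum_in_hilbert_cube:
  assumes "bij_betw a {1..d} A" "S \<subseteq> A" "a0 \<noteq> 0 \<or> S \<noteq> {}"
  shows "a0 + \<Sum> S \<in> hilbert_cube a0 d a"
proof -
  define e where "e i = (if a i \<in> S then 1 else 0 :: int)" for i
  let ?I = "{i \<in> {1..d}. a i \<in> S}"
  have inj: "inj_on a {1..d}" and img: "a ` {1..d} = A" using assms(1) by (auto simp: bij_betw_def)
  have aI: "a ` ?I = S" using img assms(2) by auto
  have "(\<Sum>i = 1..d. e i * a i) = (\<Sum>i\<in>?I. a i)"
    unfolding e_def sum.inter_filter[OF finite_atLeastAtMost] by (intro sum.cong) auto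
  also have "\<dots> = \<Sum> (a ` ?I)"
    using inj by (subst sum.reindex) (auto intro: inj_on_subset)
  finally have sum: "(\<Sum>i = 1..d. e i * a i) = \<Sum> S" using aI by simp
  have "(\<Sum>i = 1..d. e i) > 0" if "a0 = 0"
  proof -
    have "S \<noteq> {}" using assms(3) that by simp
    then obtain i where "i \<in> {1..d}" "a i \<in> S" using aI by blast
    then show ?thesis by (intro sum_pos2[of _ i]) (auto simp: e_def)
  qed
  then show ?thesis unfolding hilbert_cube_def mem_Collect_eq
    using sum by (intro exI[of _ e]) (simp add: e_def)
qed

text \<open>Splits \<open>A\<close> into \<open>B\<close> of size \<open>d div 2\<close> and its
  complement \<open>C\<close>, and applies the sieve to their sets of subset sums, each of which is
  large by the growth estimate.\<close>

lemma hilbert_cube_dim_bound: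
  fixes N a0 :: int and n :: nat
  assumes "N \<ge> 2" "a0 \<ge> 0" and bij: "bij_betw a {1..d} A" and pos: "\<And>x. x \<in> A \<Longrightarrow> x > 0"
    and H: "hilbert_cube a0 d a \<subseteq> pos_squares \<inter> {1..N}"
    and n: "n > 0" "4 * log 2 N * (sqrt (2 * real n + 1) + 1) \<le> real n * ln 4 / ln (2 * real n + 1) - 1"
  shows "(4 / 3) ^ (d div 2) \<le> 4 * (sqrt (2 * real n + 1) + 1)"
proof -
  have sqA: "(\<exists>m. a0 + s = m\<^sup>2) \<and> a0 + s \<le> N" if "s \<in> subset_sums A" for s
  proof -
    obtain S where S: "S \<subseteq> A" "s = \<Sum> S" using \<open>s \<in> _\<close> by (auto simp: subset_sums_def)
    show ?thesis
    proof (cases "a0 = 0 \<and> S = {}")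
      \<comment> \<open>For \<open>a0 = 0\<close> the cube omits the empty sum, but its value 0 is
        still a square and at most \<open>N\<close>, so all subset sums can be treated
        alike.\<close>
      case True
      then show ?thesis using S \<open>N \<ge> 2\<close> by (auto intro: exI[of _ 0])
    next
      case False
      then have "a0 + s \<in> pos_squares \<inter> {1..N}"
        using subset_sum_in_hilbert_cube[OF bij S(1), of a0] H S(2) by blast
      then show ?thesis by (auto simp: pos_squares_def)
    qed
  qed
  have finA: "finite A" and cardA: "card A = d"
    using bij bij_betw_finite bij_betw_same_card by fastforce+
  obtain B where B: "B \<subseteq> A" "card B = d div 2"
    using cardA by (metis obtain_subset_with_card_n div_le_dividend)
  define C where "C = A - B"
  have BC: "finite B" "finite C" "B \<inter> C = {}" "B \<union> C = A" using B finA by (auto simp: C_def intro: finite_subset)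
  have "card A = card B + card C" using BC card_Un_disjoint by blast
  then have cardC: "card C = d - d div 2" using B(2) cardA by simp
  have nonneg: "s \<ge> 0" if "s \<in> subset_sums D" "D \<subseteq> A" for s D
    using that pos by (fastforce simp: subset_sums_def intro!: sum_nonneg)
  have zero: "0 \<in> subset_sums D" for D by (auto simp: subset_sums_def intro: image_eqI[of _ _ "{}"])
  have add: "s + t \<in> subset_sums A" if "s \<in> subset_sums B" "t \<in> subset_sums C" for s t
    using add_subset_sums_in_subset_sums_Un[OF BC(1-3) that] BC(4) by simp
  have subB: "s \<in> subset_sums A" if "s \<in> subset_sums B" for s using add[OF that zero] by simp
  have subC: "s \<in> subset_sums A" if "s \<in> subset_sums C" for s using add[OF zero that] by simp
  have growth: "(4 / 3) ^ (d div 2) \<le> real (card (subset_sums D))"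
    if D: "finite D" "D \<subseteq> A" "d div 2 \<le> card D" "\<And>s. s \<in> subset_sums D \<Longrightarrow> s \<in> subset_sums A" for D
  proof -
    have "4 ^ card D \<le> 3 ^ card D * card (subset_sums D)"
      using D pos sqA by (intro card_subset_sums_ge[of D a0]) auto
    then have "real (4 ^ card D) \<le> real (3 ^ card D * card (subset_sums D))" by (simp only: of_nat_le_iff)
    then have "(4 / 3) ^ card D \<le> real (card (subset_sums D))" by (simp add: power_divide field_simps)
    moreover have "(4 / 3 :: real) ^ (d div 2) \<le> (4 / 3) ^ card D" using D(3) by (intro power_increasing) auto
    ultimately show ?thesis by linarith
  qed
  \<comment> \<open>The shift \<open>a0\<close> is absorbed into the first summand, so that sums of
    \<open>X\<close> and \<open>subset_sums C\<close> are squares. Both sets lie in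
    \<open>{0..N}\<close>, which bounds their differences.\<close>
  define X where "X = (+) a0 ` subset_sums B"
  have cardX: "card X = card (subset_sums B)" unfolding X_def by (intro card_image) (auto simp: inj_on_def)
  show ?thesis
  proof (rule sumset_squares_bound[where X = X and Y = "subset_sums C" and N = N])
    show "finite X" "finite (subset_sums C)" using BC by (auto simp: X_def finite_subset_sums)
    show "(4 / 3) ^ (d div 2) \<le> real (card X)"
      unfolding cardX using BC B subB by (intro growth) auto
    show "(4 / 3) ^ (d div 2) \<le> real (card (subset_sums C))"
      using BC cardC subC by (intro growth) auto
    show "\<exists>m. x + y = m\<^sup>2" if "x \<in> X" "y \<in> subset_sums C" for x y
      using that sqA add by (force simp: X_def add.assoc)
    have rangeX: "0 \<le> x \<and> x \<le> N" if x: "x \<in> X" for x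
    proof -
      obtain s where s: "s \<in> subset_sums B" "x = a0 + s" using x by (auto simp: X_def)
      then have "a0 + s \<le> N" "s \<ge> 0" using sqA subB nonneg B(1) by blast+
      then show ?thesis using s \<open>a0 \<ge> 0\<close> by simp
    qed
    show "\<bar>x - x'\<bar> \<le> N" if "x \<in> X" "x' \<in> X" for x x'
      using rangeX[OF that(1)] rangeX[OF that(2)] by linarith
    have rangeC: "0 \<le> x \<and> x \<le> N" if x: "x \<in> subset_sums C" for x
    proof -
      have "C \<subseteq> A" by (simp add: C_def)
      then have "a0 + x \<le> N" "x \<ge> 0" using sqA subC nonneg x by blast+
      then show ?thesis using \<open>a0 \<ge> 0\<close> by simp
    qed
    show "\<bar>x - x'\<bar> \<le> N" if "x \<in> subset_sums C" "x' \<in> subset_sums C" for x x'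
      using rangeC[OF that(1)] rangeC[OF that(2)] by linarith
  qed (use assms in auto)
qed

section \<open>Asymptotic inequalities and conclusion\<close>

text \<open>The left side has order \<open>x powr (1000/2006 + 1/2)\<close>, with exponent below 1,
  against \<open>x / ln x\<close> on the right. The power of \<open>x + 1\<close> stands for an
  upper bound of \<open>ln N\<close>.\<close>

lemma eventually_sieve_parameter:
  "eventually (\<lambda>x::real. 4 * ((x + 1) powr (1000/2006) / ln 2) * (sqrt (2 * x + 1) + 1)
      \<le> x * ln 4 / ln (2 * x + 1) - 1) at_top"
  by real_asymp

text \<open>With \<open>L = ln N\<close> the left side grows like
  \<open>(2.006 / 0.2876) * ln L\<close>, and the factor is below 7.\<close>

lemma eventually_final_inequality:
  "eventually (\<lambda>L::real. 1 + 2 / (2876 / 10000) * ln (4 * (sqrt (2 * L powr (2006/1000) + 1) + 1)) \<le> 7 * ln L) at_top"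
  by real_asymp

theorem theorem1:
  "\<exists>N0 :: int. \<forall>N \<ge> N0. \<forall>(a0 :: int) (d :: nat) (a :: nat \<Rightarrow> int) (A :: int set).
     a0 \<ge> 0 \<longrightarrow> bij_betw a {1..d} A \<longrightarrow> (\<forall>x \<in> A. x > 0) \<longrightarrow>
     hilbert_cube a0 d a \<subseteq> pos_squares \<inter> {1..N} \<longrightarrow>
     real d \<le> 7 * ln (ln (real_of_int N))"
proof -
  \<comment> \<open>The exponent must exceed 2 for the sieve inequality and stay below
    \<open>7 * 0.2876 = 2.0132\<close> for the final one.\<close>
  define c :: real where "c = 2006 / 1000"
  define n where "n x = nat \<lfloor>ln x powr c\<rfloor>" for x :: real
  have n_top: "filterlim (\<lambda>x. real (n x)) at_top at_top"
    unfolding n_def c_def by real_asymp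
  have L_top: "filterlim (\<lambda>x::real. ln x) at_top at_top" by real_asymp
  have "eventually (\<lambda>x. n x > 0 \<and> ln x > 0 \<and> x \<ge> 2 \<and>
     4 * ((real (n x) + 1) powr (1000/2006) / ln 2) * (sqrt (2 * real (n x) + 1) + 1)
        \<le> real (n x) * ln 4 / ln (2 * real (n x) + 1) - 1 \<and>
     1 + 2 / (2876 / 10000) * ln (4 * (sqrt (2 * ln x powr (2006/1000) + 1) + 1)) \<le> 7 * ln (ln x)) at_top"
  proof (intro eventually_conj)
    show "eventually (\<lambda>x. n x > 0) at_top"
      using filterlim_at_top_dense[THEN iffD1, OF n_top, rule_format, of 0] by simp
    show "eventually (\<lambda>x::real. ln x > 0) at_top" by real_asymp
    show "eventually (\<lambda>x::real. x \<ge> 2) at_top" by (rule eventually_ge_at_top)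
  qed (use eventually_compose_filterlim[OF eventually_sieve_parameter n_top]
       eventually_compose_filterlim[OF eventually_final_inequality L_top] in auto)
  then obtain x0 where x0: "\<And>x. x \<ge> x0 \<Longrightarrow> n x > 0 \<and> ln x > 0 \<and> x \<ge> 2 \<and>
     4 * ((real (n x) + 1) powr (1000/2006) / ln 2) * (sqrt (2 * real (n x) + 1) + 1)
        \<le> real (n x) * ln 4 / ln (2 * real (n x) + 1) - 1 \<and>
     1 + 2 / (2876 / 10000) * ln (4 * (sqrt (2 * ln x powr (2006/1000) + 1) + 1)) \<le> 7 * ln (ln x)"
    unfolding eventually_at_top_linorder by blast
  show ?thesis
  proof (intro exI[of _ "\<lceil>x0\<rceil>"] allI impI)
    fix N a0 :: int and d :: nat and a :: "nat \<Rightarrow> int" and A :: "int set"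
    assume N: "\<lceil>x0\<rceil> \<le> N" and hyps: "a0 \<ge> 0" "bij_betw a {1..d} A" "\<forall>x\<in>A. x > 0"
      "hilbert_cube a0 d a \<subseteq> pos_squares \<inter> {1..N}"
    define L where "L = ln (real_of_int N)"
    define m where "m = n (real_of_int N)"
    have "real_of_int N \<ge> x0" using N by (simp add: ceiling_le_iff)
    from x0[OF this] have m: "m > 0" and L: "L > 0" and N2: "N \<ge> 2"
      and sieve: "4 * ((real m + 1) powr (1000/2006) / ln 2) * (sqrt (2 * real m + 1) + 1)
        \<le> real m * ln 4 / ln (2 * real m + 1) - 1"
      and fin: "1 + 2 / (2876 / 10000) * ln (4 * (sqrt (2 * L powr (2006/1000) + 1) + 1)) \<le> 7 * ln L"
      unfolding L_def m_def by auto
    have "real m = of_int \<lfloor>L powr c\<rfloor>" by (simp add: m_def n_def L_def)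
    then have m_le: "real m \<le> L powr c" and m_ge: "L powr c \<le> real m + 1" by linarith+
    \<comment> \<open>As \<open>1000 / 2006\<close> is \<open>1 / c\<close>, this recovers an upper
      bound for \<open>ln N\<close> from \<open>m\<close>; the \<open>+ 1\<close> makes up for the
      floor in \<open>n\<close>.\<close>
    have "L = (L powr c) powr (1000 / 2006)" using L by (simp add: powr_powr c_def)
    also have "\<dots> \<le> (real m + 1) powr (1000 / 2006)" using m_ge by (intro powr_mono2) auto
    finally have "log 2 N \<le> (real m + 1) powr (1000 / 2006) / ln 2"
      by (simp add: log_def L_def divide_right_mono)
    then have "4 * log 2 N * (sqrt (2 * real m + 1) + 1) \<le>
        4 * ((real m + 1) powr (1000/2006) / ln 2) * (sqrt (2 * real m + 1) + 1)"
      by (intro mult_right_mono mult_left_mono) auto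
    also note sieve
    finally have "(4 / 3) ^ (d div 2) \<le> 4 * (sqrt (2 * real m + 1) + 1)"
      using hyps N2 m by (intro hilbert_cube_dim_bound[where N = N and a = a and A = A]) (auto simp: add.commute)
    also have "\<dots> \<le> 4 * (sqrt (2 * L powr c + 1) + 1)" using m_le by simp
    finally have "ln ((4 / 3) ^ (d div 2)) \<le> ln (4 * (sqrt (2 * L powr c + 1) + 1))"
      by (subst ln_le_cancel_iff) (auto intro: add_nonneg_pos)
    then have "real (d div 2) * ln (4 / 3) \<le> ln (4 * (sqrt (2 * L powr c + 1) + 1))"
      by (simp add: ln_realpow)
    moreover have "real (d div 2) * (2876 / 10000) \<le> real (d div 2) * ln (4 / 3)"
      by (intro mult_left_mono ln_four_thirds) auto
    \<comment> \<open>For odd \<open>d\<close> the halving loses one dimension; this is the leading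
      1 in the final inequality.\<close>
    moreover have "real d \<le> 1 + 2 * real (d div 2)" by linarith
    ultimately have "real d \<le> 1 + 2 / (2876 / 10000) * ln (4 * (sqrt (2 * L powr (2006/1000) + 1) + 1))"
      unfolding c_def by simp
    with fin show "real d \<le> 7 * ln (ln (real_of_int N))" unfolding L_def by linarith
  qed
qed

end
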